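(* Let $(\tilde M^{2l+1},\phi,\xi,\eta,\tilde g)$ be a nearly $\alpha$-Sasakian manifold, where $\alpha$ is a nowhere vanishing smooth function on $\tilde M^{2l+1}$. There is no mixed totally geodesic warped product submanifold $M^n=N_1\times_f N_2$ of $\tilde M^{2l+1}$ with $\xi$ tangent to the first factor $N_1$.
   Context: An almost contact metric manifold $(\tilde M^{2l+1},\phi,\xi,\eta,\tilde g)$ is an odd-dimensional smooth manifold with a $(1,1)$ tensor field $\phi$, a vector field $\xi$ (the characteristic vector field), a $1$-form $\eta$ and a Riemannian metric $\tilde g$ satisfying $\phi^2=-I+\eta\otimes\xi$, $\phi\xi=0$, $\eta\circ\phi=0$, $\eta(\xi)=1$, $\eta(X)=\tilde g(X,\xi)$, $\tilde g(\phi X,\phi Y)=\tilde g(X,Y)-\eta(X)\eta(Y)$ for all vector fields $X,Y$. Let $\tilde\nabla$ be the Levi-Civita connection of $\tilde g$ and $(\tilde\nabla_X\phi)Y=\tilde\nabla_X(\phi Y)-\phi\tilde\nabla_XY$. The manifold is nearly $\alpha$-Sasakian if for all vector fields $X,Y$ $$(\tilde\nabla_X\phi)Y+(\tilde\nabla_Y\phi)X=\alpha\bigl(2\tilde g(X,Y)\xi-\eta(Y)X-\eta(X)Y\bigr).$$ Let $(N_1,g_{N_1})$, $(N_2,g_{N_2})$ be Riemannian manifolds of positive dimension and $f>0$ a smooth function on $N_1$. The warped product $N_1\times_f N_2$ is the manifold $N_1\times N_2$ with the Riemannian metric $g_{N_1}+f^2g_{N_2}$ (pullbacks by the projections understood).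 A warped product submanifold of $\tilde M$ is a warped product isometrically immersed in $\tilde M$. Vector fields on the factors are identified with their lifts to $N_1\times N_2$, and "$\xi$ tangent to $N_1$" means $\xi|_M\in\Gamma(TN_1)$. Let $h$ be the second fundamental form of $M^n$ in $\tilde M^{2l+1}$, defined by the Gauss formula $\tilde\nabla_XY=\nabla_XY+h(X,Y)$ with $\nabla$ the Levi-Civita connection of $M^n$. The submanifold $N_1\times_fN_2$ is mixed totally geodesic if $h(X,Z)=0$ for all $X$ tangent to $N_1$ and $Z$ tangent to $N_2$. *)

theory Defs
  imports "HOL-Analysis.Analysis"
begin

section \<open>Smooth maps between open subsets of Euclidean spaces\<close>

text \<open>\<open>Ck_on k S f\<close> is only meant for open \<open>S\<close>.\<close>

primrec Ck_on :: "nat \<Rightarrow> 'e::euclidean_space set \<Rightarrow> ('e \<Rightarrow> 'f::euclidean_space) \<Rightarrow> bool" where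
  "Ck_on 0 S f \<longleftrightarrow> continuous_on S f"
| "Ck_on (Suc k) S f \<longleftrightarrow>
     (\<forall>x\<in>S. f differentiable (at x)) \<and>
     (\<forall>v. Ck_on k S (\<lambda>x. frechet_derivative f (at x) v))"

definition smooth_on :: "'e::euclidean_space set \<Rightarrow> ('e \<Rightarrow> 'f::euclidean_space) \<Rightarrow> bool" where
  "smooth_on S f \<longleftrightarrow> (\<forall>k. Ck_on k S f)"


section \<open>Smooth manifolds\<close>

text \<open>
  A manifold is a type of points carrying a Hausdorff, second countable topology, together with a
  smooth atlas. Its model space is a Euclidean space \<open>'e\<close>, so its dimension is \<open>DIM('e)\<close>, which is
  always positive. A chart is a pair of a domain and a coordinate map; the values of the map outside
  the domain are irrelevant.
\<close>

type_synonym ('a, 'e) chart = "'a set \<times> ('a \<Rightarrow> 'e)"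

definition smooth_atlas ::
  "('a::{t2_space,second_countable_topology}, 'e::euclidean_space) chart set \<Rightarrow> bool" where
  "smooth_atlas A \<longleftrightarrow>
     (\<Union>(U, c)\<in>A. U) = UNIV \<and>
     (\<forall>(U, c)\<in>A. open U \<and> open (c ` U) \<and> homeomorphism U (c ` U) c (inv_into U c)) \<and>
     (\<forall>(U, c)\<in>A. \<forall>(V, d)\<in>A. smooth_on (c ` (U \<inter> V)) (d \<circ> inv_into U c))"

definition prod_atlas ::
  "('a, 'e) chart set \<Rightarrow> ('b, 'f) chart set \<Rightarrow> ('a \<times> 'b, 'e \<times> 'f) chart set" where
  "prod_atlas A B = {(U \<times> V, map_prod c d) | U c V d. (U, c) \<in> A \<and> (V, d) \<in> B}"

definition smooth_funs :: "('a, 'e::euclidean_space) chart set \<Rightarrow> ('a \<Rightarrow> real) set" where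
  "smooth_funs A = {f. \<forall>(U, c)\<in>A. smooth_on (c ` U) (f \<circ> inv_into U c)}"

definition smooth_map ::
  "('a::topological_space, 'e::euclidean_space) chart set \<Rightarrow>
   ('b::topological_space, 'f::euclidean_space) chart set \<Rightarrow> ('a \<Rightarrow> 'b) \<Rightarrow> bool" where
  "smooth_map A B F \<longleftrightarrow>
     continuous_on UNIV F \<and>
     (\<forall>(U, c)\<in>A. \<forall>(V, d)\<in>B. smooth_on (c ` (U \<inter> F -` V)) (d \<circ> F \<circ> inv_into U c))"


section \<open>Tangent vectors and vector fields\<close>

text \<open>
  A tangent vector at \<open>p\<close> is a directional derivative operator at \<open>p\<close>, acting on smooth functions; on
  all other functions it takes the value 0 by convention, so that equality of tangent vectors is
  equality of functionals. Linear combinations are formed pointwise.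
\<close>

type_synonym 'a tangent = "('a \<Rightarrow> real) \<Rightarrow> real"

definition coord_vector ::
  "('a, 'e::euclidean_space) chart set \<Rightarrow> ('a, 'e) chart \<Rightarrow> 'a \<Rightarrow> 'e \<Rightarrow> 'a tangent" where
  "coord_vector A = (\<lambda>(U, c) p w f.
     if f \<in> smooth_funs A then frechet_derivative (f \<circ> inv_into U c) (at (c p)) w else 0)"

definition tangent_space :: "('a, 'e::euclidean_space) chart set \<Rightarrow> 'a \<Rightarrow> 'a tangent set" where
  "tangent_space A p = {coord_vector A (U, c) p w | U c w. (U, c) \<in> A \<and> p \<in> U}"

definition zero_vector :: "'a tangent" where
  "zero_vector = (\<lambda>f. 0)"

definition lincomb :: "real \<Rightarrow> 'a tangent \<Rightarrow> real \<Rightarrow> 'a tangent \<Rightarrow> 'a tangent" where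
  "lincomb a u b v = (\<lambda>f. a * u f + b * v f)"

text \<open>Smooth sections of the pullback of the tangent bundle of \<open>B\<close> along \<open>F\<close>.\<close>

definition fields_along ::
  "('a, 'e::euclidean_space) chart set \<Rightarrow> ('b, 'f::euclidean_space) chart set \<Rightarrow> ('a \<Rightarrow> 'b) \<Rightarrow>
   ('a \<Rightarrow> 'b tangent) set" where
  "fields_along A B F =
     {V. (\<forall>p. V p \<in> tangent_space B (F p)) \<and>
         (\<forall>f\<in>smooth_funs B. (\<lambda>p. V p f) \<in> smooth_funs A)}"

abbreviation vector_fields :: "('a, 'e::euclidean_space) chart set \<Rightarrow> ('a \<Rightarrow> 'a tangent) set" where
  "vector_fields A \<equiv> fields_along A A (\<lambda>p. p)"

text \<open>The differential of a smooth map \<open>F\<close> into \<open>B\<close>, acting on tangent vectors.\<close>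

definition differential ::
  "('b, 'f::euclidean_space) chart set \<Rightarrow> ('a \<Rightarrow> 'b) \<Rightarrow> 'a tangent \<Rightarrow> 'b tangent" where
  "differential B F v = (\<lambda>f. if f \<in> smooth_funs B then v (f \<circ> F) else 0)"


section \<open>Tensor fields, Riemannian metrics and connections\<close>

definition one_form ::
  "('a, 'e::euclidean_space) chart set \<Rightarrow> ('a \<Rightarrow> 'a tangent \<Rightarrow> real) \<Rightarrow> bool" where
  "one_form A \<eta> \<longleftrightarrow>
     (\<forall>p. \<forall>u\<in>tangent_space A p. \<forall>v\<in>tangent_space A p. \<forall>a b.
        \<eta> p (lincomb a u b v) = a * \<eta> p u + b * \<eta> p v) \<and>
     (\<forall>X\<in>vector_fields A. (\<lambda>p. \<eta> p (X p)) \<in> smooth_funs A)"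

definition tensor11 ::
  "('a, 'e::euclidean_space) chart set \<Rightarrow> ('a \<Rightarrow> 'a tangent \<Rightarrow> 'a tangent) \<Rightarrow> bool" where
  "tensor11 A \<phi> \<longleftrightarrow>
     (\<forall>p. \<forall>u\<in>tangent_space A p. \<phi> p u \<in> tangent_space A p) \<and>
     (\<forall>p. \<forall>u\<in>tangent_space A p. \<forall>v\<in>tangent_space A p. \<forall>a b.
        \<phi> p (lincomb a u b v) = lincomb a (\<phi> p u) b (\<phi> p v)) \<and>
     (\<forall>X\<in>vector_fields A. (\<lambda>p. \<phi> p (X p)) \<in> vector_fields A)"

definition riemannian_metric ::
  "('a, 'e::euclidean_space) chart set \<Rightarrow> ('a \<Rightarrow> 'a tangent \<Rightarrow> 'a tangent \<Rightarrow> real) \<Rightarrow> bool" where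
  "riemannian_metric A g \<longleftrightarrow>
     (\<forall>p. \<forall>u\<in>tangent_space A p. \<forall>v\<in>tangent_space A p. \<forall>w\<in>tangent_space A p. \<forall>a b.
        g p (lincomb a u b v) w = a * g p u w + b * g p v w) \<and>
     (\<forall>p. \<forall>u\<in>tangent_space A p. \<forall>v\<in>tangent_space A p. g p u v = g p v u) \<and>
     (\<forall>p. \<forall>u\<in>tangent_space A p. u \<noteq> zero_vector \<longrightarrow> g p u u > 0) \<and>
     (\<forall>X\<in>vector_fields A. \<forall>Y\<in>vector_fields A. (\<lambda>p. g p (X p) (Y p)) \<in> smooth_funs A)"

text \<open>
  Connections on the pullback of the tangent bundle of \<open>B\<close> along \<open>F\<close>; only the values of \<open>D\<close> on
  smooth fields matter. For \<open>F\<close> the identity these are the affine connections.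
\<close>

definition connection_along ::
  "('a, 'e::euclidean_space) chart set \<Rightarrow> ('b, 'f::euclidean_space) chart set \<Rightarrow> ('a \<Rightarrow> 'b) \<Rightarrow>
   (('a \<Rightarrow> 'a tangent) \<Rightarrow> ('a \<Rightarrow> 'b tangent) \<Rightarrow> 'a \<Rightarrow> 'b tangent) \<Rightarrow> bool" where
  "connection_along A B F D \<longleftrightarrow>
     (\<forall>X\<in>vector_fields A. \<forall>V\<in>fields_along A B F. D X V \<in> fields_along A B F) \<and>
     (\<forall>X\<in>vector_fields A. \<forall>Y\<in>vector_fields A. \<forall>V\<in>fields_along A B F.
      \<forall>a\<in>smooth_funs A. \<forall>b\<in>smooth_funs A.
        D (\<lambda>p. lincomb (a p) (X p) (b p) (Y p)) V =
        (\<lambda>p. lincomb (a p) (D X V p) (b p) (D Y V p))) \<and>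
     (\<forall>X\<in>vector_fields A. \<forall>V\<in>fields_along A B F. \<forall>W\<in>fields_along A B F.
        D X (\<lambda>p. lincomb 1 (V p) 1 (W p)) = (\<lambda>p. lincomb 1 (D X V p) 1 (D X W p))) \<and>
     (\<forall>X\<in>vector_fields A. \<forall>V\<in>fields_along A B F. \<forall>a\<in>smooth_funs A.
        D X (\<lambda>p f. a p * V p f) = (\<lambda>p. lincomb (X p a) (V p) (a p) (D X V p)))"

abbreviation affine_connection ::
  "('a, 'e::euclidean_space) chart set \<Rightarrow>
   (('a \<Rightarrow> 'a tangent) \<Rightarrow> ('a \<Rightarrow> 'a tangent) \<Rightarrow> 'a \<Rightarrow> 'a tangent) \<Rightarrow> bool" where
  "affine_connection A D \<equiv> connection_along A A (\<lambda>p. p) D"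

definition lie_bracket ::
  "('a, 'e::euclidean_space) chart set \<Rightarrow> ('a \<Rightarrow> 'a tangent) \<Rightarrow> ('a \<Rightarrow> 'a tangent) \<Rightarrow> 'a \<Rightarrow> 'a tangent"
  where
  "lie_bracket A X Y = (\<lambda>p f.
     if f \<in> smooth_funs A then X p (\<lambda>q. Y q f) - Y p (\<lambda>q. X q f) else 0)"

definition levi_civita ::
  "('a, 'e::euclidean_space) chart set \<Rightarrow> ('a \<Rightarrow> 'a tangent \<Rightarrow> 'a tangent \<Rightarrow> real) \<Rightarrow>
   (('a \<Rightarrow> 'a tangent) \<Rightarrow> ('a \<Rightarrow> 'a tangent) \<Rightarrow> 'a \<Rightarrow> 'a tangent) \<Rightarrow> bool" where
  "levi_civita A g D \<longleftrightarrow>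
     affine_connection A D \<and>
     (\<forall>X\<in>vector_fields A. \<forall>Y\<in>vector_fields A. \<forall>p.
        lincomb 1 (D X Y p) (-1) (D Y X p) = lie_bracket A X Y p) \<and>
     (\<forall>X\<in>vector_fields A. \<forall>Y\<in>vector_fields A. \<forall>Z\<in>vector_fields A. \<forall>p.
        X p (\<lambda>q. g q (Y q) (Z q)) = g p (D X Y p) (Z p) + g p (Y p) (D X Z p))"


section \<open>Nearly \<open>\<alpha>\<close>-Sasakian manifolds\<close>

definition almost_contact_metric ::
  "('a, 'e::euclidean_space) chart set \<Rightarrow> ('a \<Rightarrow> 'a tangent \<Rightarrow> 'a tangent) \<Rightarrow>
   ('a \<Rightarrow> 'a tangent) \<Rightarrow> ('a \<Rightarrow> 'a tangent \<Rightarrow> real) \<Rightarrow>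
   ('a \<Rightarrow> 'a tangent \<Rightarrow> 'a tangent \<Rightarrow> real) \<Rightarrow> bool" where
  "almost_contact_metric A \<phi> \<xi> \<eta> g \<longleftrightarrow>
     odd DIM('e) \<and>
     tensor11 A \<phi> \<and> \<xi> \<in> vector_fields A \<and> one_form A \<eta> \<and> riemannian_metric A g \<and>
     (\<forall>p. \<forall>u\<in>tangent_space A p. \<phi> p (\<phi> p u) = lincomb (-1) u (\<eta> p u) (\<xi> p)) \<and>
     (\<forall>p. \<phi> p (\<xi> p) = zero_vector) \<and>
     (\<forall>p. \<forall>u\<in>tangent_space A p. \<eta> p (\<phi> p u) = 0) \<and>
     (\<forall>p. \<eta> p (\<xi> p) = 1) \<and>
     (\<forall>p. \<forall>u\<in>tangent_space A p. \<eta> p u = g p u (\<xi> p)) \<and>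
     (\<forall>p. \<forall>u\<in>tangent_space A p. \<forall>v\<in>tangent_space A p.
        g p (\<phi> p u) (\<phi> p v) = g p u v - \<eta> p u * \<eta> p v)"

definition cov_deriv_tensor11 ::
  "(('a \<Rightarrow> 'a tangent) \<Rightarrow> ('a \<Rightarrow> 'a tangent) \<Rightarrow> 'a \<Rightarrow> 'a tangent) \<Rightarrow>
   ('a \<Rightarrow> 'a tangent \<Rightarrow> 'a tangent) \<Rightarrow>
   ('a \<Rightarrow> 'a tangent) \<Rightarrow> ('a \<Rightarrow> 'a tangent) \<Rightarrow> 'a \<Rightarrow> 'a tangent" where
  "cov_deriv_tensor11 D \<phi> X Y p = lincomb 1 (D X (\<lambda>q. \<phi> q (Y q)) p) (-1) (\<phi> p (D X Y p))"

text \<open>\<open>D\<close> stands for the Levi-Civita connection of \<open>g\<close>.\<close>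

definition nearly_sasakian ::
  "('a, 'e::euclidean_space) chart set \<Rightarrow> ('a \<Rightarrow> 'a tangent \<Rightarrow> 'a tangent) \<Rightarrow>
   ('a \<Rightarrow> 'a tangent) \<Rightarrow> ('a \<Rightarrow> 'a tangent \<Rightarrow> real) \<Rightarrow>
   ('a \<Rightarrow> 'a tangent \<Rightarrow> 'a tangent \<Rightarrow> real) \<Rightarrow>
   (('a \<Rightarrow> 'a tangent) \<Rightarrow> ('a \<Rightarrow> 'a tangent) \<Rightarrow> 'a \<Rightarrow> 'a tangent) \<Rightarrow> ('a \<Rightarrow> real) \<Rightarrow> bool" where
  "nearly_sasakian A \<phi> \<xi> \<eta> g D \<alpha> \<longleftrightarrow>
     almost_contact_metric A \<phi> \<xi> \<eta> g \<and>
     levi_civita A g D \<and>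
     (\<forall>X\<in>vector_fields A. \<forall>Y\<in>vector_fields A. \<forall>p.
        lincomb 1 (cov_deriv_tensor11 D \<phi> X Y p) 1 (cov_deriv_tensor11 D \<phi> Y X p) =
        (\<lambda>f. \<alpha> p * (2 * g p (X p) (Y p) * \<xi> p f - \<eta> p (Y p) * X p f - \<eta> p (X p) * Y p f)))"


section \<open>Warped product submanifolds\<close>

definition warped_metric ::
  "('b, 'f::euclidean_space) chart set \<Rightarrow> ('b \<Rightarrow> 'b tangent \<Rightarrow> 'b tangent \<Rightarrow> real) \<Rightarrow>
   ('c, 'h::euclidean_space) chart set \<Rightarrow> ('c \<Rightarrow> 'c tangent \<Rightarrow> 'c tangent \<Rightarrow> real) \<Rightarrow>
   ('b \<Rightarrow> real) \<Rightarrow> 'b \<times> 'c \<Rightarrow> ('b \<times> 'c) tangent \<Rightarrow> ('b \<times> 'c) tangent \<Rightarrow> real" where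
  "warped_metric N1 g1 N2 g2 f p u v =
     g1 (fst p) (differential N1 fst u) (differential N1 fst v) +
     (f (fst p))\<^sup>2 * g2 (snd p) (differential N2 snd u) (differential N2 snd v)"

text \<open>
  Sections of the distributions \<open>TN1\<close> and \<open>TN2\<close> on the product: fields annihilated by the
  differential of the projection onto the other factor. Lifts of vector fields on the factors are
  special cases.
\<close>

definition first_factor_fields ::
  "('b, 'f::euclidean_space) chart set \<Rightarrow> ('c, 'h::euclidean_space) chart set \<Rightarrow>
   ('b \<times> 'c \<Rightarrow> ('b \<times> 'c) tangent) set" where
  "first_factor_fields N1 N2 =
     {X \<in> vector_fields (prod_atlas N1 N2). \<forall>p. differential N2 snd (X p) = zero_vector}"

definition second_factor_fields ::
  "('b, 'f::euclidean_space) chart set \<Rightarrow> ('c, 'h::euclidean_space) chart set \<Rightarrow>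
   ('b \<times> 'c \<Rightarrow> ('b \<times> 'c) tangent) set" where
  "second_factor_fields N1 N2 =
     {Z \<in> vector_fields (prod_atlas N1 N2). \<forall>p. differential N1 fst (Z p) = zero_vector}"

definition isometric_immersion ::
  "('a::topological_space, 'e::euclidean_space) chart set \<Rightarrow>
   ('a \<Rightarrow> 'a tangent \<Rightarrow> 'a tangent \<Rightarrow> real) \<Rightarrow>
   ('b::topological_space, 'f::euclidean_space) chart set \<Rightarrow>
   ('b \<Rightarrow> 'b tangent \<Rightarrow> 'b tangent \<Rightarrow> real) \<Rightarrow> ('a \<Rightarrow> 'b) \<Rightarrow> bool" where
  "isometric_immersion A g B g' F \<longleftrightarrow>
     smooth_map A B F \<and>
     (\<forall>p. inj_on (differential B F) (tangent_space A p)) \<and>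
     (\<forall>p. \<forall>u\<in>tangent_space A p. \<forall>v\<in>tangent_space A p.
        g' (F p) (differential B F u) (differential B F v) = g p u v)"

text \<open>
  For fields \<open>X\<close>, \<open>Y\<close> tangent to an immersed submanifold, the covariant derivative of \<open>Y\<close> in the
  direction \<open>X\<close> taken in the ambient manifold is the one given by the pullback along the immersion
  \<open>F\<close> of the ambient connection \<open>D\<close>. The pullback is the unique connection along \<open>F\<close> that agrees
  with \<open>D\<close> on restrictions to \<open>A\<close> of fields on \<open>B\<close>.
\<close>

definition pullback_connection ::
  "('a, 'e::euclidean_space) chart set \<Rightarrow> ('b, 'f::euclidean_space) chart set \<Rightarrow> ('a \<Rightarrow> 'b) \<Rightarrow>
   (('b \<Rightarrow> 'b tangent) \<Rightarrow> ('b \<Rightarrow> 'b tangent) \<Rightarrow> 'b \<Rightarrow> 'b tangent) \<Rightarrow>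
   (('a \<Rightarrow> 'a tangent) \<Rightarrow> ('a \<Rightarrow> 'b tangent) \<Rightarrow> 'a \<Rightarrow> 'b tangent) \<Rightarrow> bool" where
  "pullback_connection A B F D DF \<longleftrightarrow>
     connection_along A B F DF \<and>
     (\<forall>X\<in>vector_fields A. \<forall>W\<in>vector_fields B. \<forall>Y\<in>vector_fields B. \<forall>p.
        W (F p) = differential B F (X p) \<longrightarrow> DF X (\<lambda>q. Y (F q)) p = D W Y (F p))"

text \<open>
  Gauss formula: \<open>DA\<close> stands for the Levi-Civita connection of the submanifold \<open>A\<close> immersed in \<open>B\<close>
  by \<open>F\<close>, and \<open>DF\<close> for the pullback along \<open>F\<close> of the Levi-Civita connection of \<open>B\<close>.
\<close>

definition second_fundamental_form ::
  "('b, 'f::euclidean_space) chart set \<Rightarrow> ('a \<Rightarrow> 'b) \<Rightarrow>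
   (('a \<Rightarrow> 'a tangent) \<Rightarrow> ('a \<Rightarrow> 'a tangent) \<Rightarrow> 'a \<Rightarrow> 'a tangent) \<Rightarrow>
   (('a \<Rightarrow> 'a tangent) \<Rightarrow> ('a \<Rightarrow> 'b tangent) \<Rightarrow> 'a \<Rightarrow> 'b tangent) \<Rightarrow>
   ('a \<Rightarrow> 'a tangent) \<Rightarrow> ('a \<Rightarrow> 'a tangent) \<Rightarrow> 'a \<Rightarrow> 'b tangent" where
  "second_fundamental_form B F DA DF X Y p =
     lincomb 1 (DF X (\<lambda>q. differential B F (Y q)) p) (-1) (differential B F (DA X Y p))"

definition mixed_totally_geodesic ::
  "('b, 'f::euclidean_space) chart set \<Rightarrow> ('c, 'h::euclidean_space) chart set \<Rightarrow>
   ('a, 'e::euclidean_space) chart set \<Rightarrow> ('b \<times> 'c \<Rightarrow> 'a) \<Rightarrow>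
   (('b \<times> 'c \<Rightarrow> ('b \<times> 'c) tangent) \<Rightarrow> ('b \<times> 'c \<Rightarrow> ('b \<times> 'c) tangent) \<Rightarrow>
     'b \<times> 'c \<Rightarrow> ('b \<times> 'c) tangent) \<Rightarrow>
   (('b \<times> 'c \<Rightarrow> ('b \<times> 'c) tangent) \<Rightarrow> ('b \<times> 'c \<Rightarrow> 'a tangent) \<Rightarrow> 'b \<times> 'c \<Rightarrow> 'a tangent) \<Rightarrow>
   bool" where
  "mixed_totally_geodesic N1 N2 B F DA DF \<longleftrightarrow>
     (\<forall>X\<in>first_factor_fields N1 N2. \<forall>Z\<in>second_factor_fields N1 N2. \<forall>p.
        second_fundamental_form B F DA DF X Z p = zero_vector)"

definition tangent_to_first_factor ::
  "('b, 'f::euclidean_space) chart set \<Rightarrow> ('c, 'h::euclidean_space) chart set \<Rightarrow>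
   ('a, 'e::euclidean_space) chart set \<Rightarrow> ('b \<times> 'c \<Rightarrow> 'a) \<Rightarrow> ('a \<Rightarrow> 'a tangent) \<Rightarrow> bool" where
  "tangent_to_first_factor N1 N2 B F \<xi> \<longleftrightarrow>
     (\<exists>X\<in>first_factor_fields N1 N2. \<forall>p. differential B F (X p) = \<xi> (F p))"

end

theory Submission
  imports Defs "HOL-Real_Asymp.Real_Asymp"
begin

text \<open>
Let \<open>X0\<close> be the field on \<open>N1 \<times> N2\<close> that the immersion \<open>F\<close> maps to \<open>\<xi>\<close>, and let \<open>Z\<close> be tangent to the
second factor. Pairing the nearly Sasakian condition for the fields \<open>W\<close> and \<open>\<xi>\<close> with \<open>W\<close> gives
\<open>g (\<nabla>\<^sub>W \<xi>) (\<phi> W) = - \<alpha> (|W|\<^sup>2 - (\<eta> W)\<^sup>2)\<close> (lemma \<open>D_xi_phi\<close>). Since \<open>\<xi>\<close> is tangent to the first factor,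
\<open>\<eta>\<close> vanishes on the image of \<open>Z\<close>; so once the ambient derivative of \<open>\<xi>\<close> in the direction \<open>Z\<close> is known to
vanish, \<open>\<alpha> |Z|\<^sup>2 = 0\<close>, which is absurd at a point where \<open>Z\<close> is not zero.

The pullback connection is torsion free, so \<open>h X0 Z = 0\<close> also gives \<open>h Z X0 = 0\<close>, and the ambient
derivative of \<open>\<xi>\<close> along \<open>Z\<close> is the image of \<open>u = \<nabla>\<^sub>Z X0\<close>, computed on the product. The field \<open>X0\<close> is a
section of \<open>TN1\<close> but need not be the lift of a field on \<open>N1\<close>, hence the familiar formula
\<open>\<nabla>\<^sub>Z X0 = X0 (ln f) Z\<close> is not available. What replaces it is that \<open>\<xi>\<close> is a Killing field, for every
function \<open>\<alpha>\<close> (lemma \<open>xi_Killing\<close>): pairing the nearly Sasakian condition for \<open>X\<close> and \<open>\<xi>\<close> with \<open>\<phi> X\<close>, all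
terms cancel. Then \<open>u = 0\<close>, because it is orthogonal to both factors.

 \<^item> For \<open>V\<close> tangent to the second factor, \<open>\<langle>\<nabla>\<^sub>Z X0, V\<rangle> = - \<langle>X0, \<nabla>\<^sub>Z V\<rangle>\<close> is skew in \<open>Z\<close> and \<open>V\<close> because \<open>\<xi>\<close>
   is Killing, and symmetric because \<open>[Z, V]\<close> is again tangent to the second factor.
 \<^item> For \<open>X\<close> tangent to the first factor, the Killing property turns \<open>\<langle>\<nabla>\<^sub>Z X0, X\<rangle>\<close> into the ambient
   \<open>- \<langle>\<nabla>\<^sub>X \<xi>, Z\<rangle> = \<langle>\<xi>, \<nabla>\<^sub>X Z\<rangle>\<close>, which equals \<open>\<langle>X0, \<nabla>\<^sub>X Z\<rangle>\<close> on the product because \<open>h X Z = 0\<close>. The leaves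
   \<open>N1 \<times> {y}\<close> are totally geodesic in a warped product, so this is zero.

Tangent vectors act on globally defined smooth functions and connections on globally defined fields.
Local computations therefore go through cutoff functions and local frames; what the argument above uses of
them is contained in the lemmas \<open>metric_along_derivative\<close>, \<open>pullback_metric\<close> and \<open>pullback_torsion_free\<close>,
and in the extension of tangent vectors to global fields (lemma \<open>field_extension\<close>).
\<close>

section \<open>Calculus of smooth maps\<close>

lemma Ck_on_cong:
  assumes "open S" "\<And>x. x \<in> S \<Longrightarrow> f x = g x" "Ck_on k S f"
  shows "Ck_on k S g"
  using assms(2,3)
proof (induction k arbitrary: f g)
  case 0
  then show ?case using continuous_on_cong by force
next
  case (Suc k)
  have D: "(g has_derivative frechet_derivative f (at x)) (at x)" if "x \<in> S" for x
    using Suc.prems that frechet_derivative_works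
    by (metis Ck_on.simps(2) assms(1) has_derivative_transform_within_open)
  have "Ck_on k S (\<lambda>x. frechet_derivative g (at x) v)" for v
  proof (rule Suc.IH)
    show "Ck_on k S (\<lambda>x. frechet_derivative f (at x) v)" using Suc.prems by simp
  qed (use D frechet_derivative_at in metis)
  then show ?case using D by (auto simp: differentiable_def)
qed

text \<open>
The definition of \<open>Ck_on\<close> refers to \<open>frechet_derivative\<close>; this rule accepts any expression for the
derivative on the open set.
\<close>

lemma Ck_on_SucI:
  assumes "open S" "\<And>x. x \<in> S \<Longrightarrow> (f has_derivative f' x) (at x)"
    and "\<And>v. Ck_on k S (\<lambda>x. f' x v)"
  shows "Ck_on (Suc k) S f"
proof -
  have "frechet_derivative f (at x) = f' x" if "x \<in> S" for x
    using assms(2)[OF that] frechet_derivative_at by metis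
  then have "Ck_on k S (\<lambda>x. frechet_derivative f (at x) v)" for v
    by (intro Ck_on_cong[OF assms(1) _ assms(3)[of v]]) simp
  then show ?thesis using assms(2) by (auto simp: differentiable_def)
qed

lemma Ck_on_SucD:
  "Ck_on (Suc k) S f \<Longrightarrow> x \<in> S \<Longrightarrow> (f has_derivative frechet_derivative f (at x)) (at x)"
  by (simp add: frechet_derivative_works)

lemma Ck_on_Suc_imp: "Ck_on (Suc k) S f \<Longrightarrow> Ck_on k S f"
proof (induction k arbitrary: f)
  case 0
  then show ?case
    by (auto intro!: differentiable_imp_continuous_on simp: differentiable_on_def differentiable_at_withinI)
next
  case (Suc k)
  then show ?case by (auto simp del: Ck_on.simps(1))
qed

lemma Ck_on_subset: "Ck_on k S f \<Longrightarrow> T \<subseteq> S \<Longrightarrow> Ck_on k T f"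
  by (induction k arbitrary: f) (auto intro: continuous_on_subset)

lemma Ck_on_local:
  assumes "\<And>x. x \<in> S \<Longrightarrow> \<exists>T. open T \<and> x \<in> T \<and> Ck_on k T f"
  shows "Ck_on k S f"
  using assms
proof (induction k arbitrary: f)
  case 0
  then show ?case
    by (auto intro!: continuous_at_imp_continuous_on) (metis continuous_on_eq_continuous_at)
next
  case (Suc k)
  have "\<exists>T. open T \<and> x \<in> T \<and> Ck_on k T (\<lambda>x. frechet_derivative f (at x) v)" if "x \<in> S" for x v
    using Suc.prems[OF that] by auto
  then have "Ck_on k S (\<lambda>x. frechet_derivative f (at x) v)" for v
    using Suc.IH by blast
  moreover have "\<forall>x\<in>S. f differentiable (at x)" using Suc.prems by fastforce
  ultimately show ?case by simp
qed

lemma Ck_on_const: "open S \<Longrightarrow> Ck_on k S (\<lambda>x. c)"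
proof (induction k arbitrary: c)
  case (Suc k)
  show ?case by (rule Ck_on_SucI[OF \<open>open S\<close> has_derivative_const Suc.IH[OF \<open>open S\<close>]])
qed auto

lemma Ck_on_linear_compose:
  assumes "bounded_linear L" "open S" "Ck_on k S f"
  shows "Ck_on k S (\<lambda>x. L (f x))"
  using assms(3)
proof (induction k arbitrary: f)
  case 0
  then show ?case using assms(1) bounded_linear.continuous_on by auto
next
  case (Suc k)
  show ?case
    by (rule Ck_on_SucI[OF \<open>open S\<close> bounded_linear.has_derivative[OF assms(1) Ck_on_SucD[OF Suc.prems]]])
      (use Suc in auto)
qed

lemma Ck_on_linear:
  assumes "bounded_linear L" "open S"
  shows "Ck_on k S L"
proof (cases k)
  case 0
  then show ?thesis using assms linear_continuous_on by auto
next
  case (Suc m)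
  then show ?thesis
    using Ck_on_SucI[OF \<open>open S\<close> bounded_linear_imp_has_derivative[OF assms(1)]] Ck_on_const[OF \<open>open S\<close>] by blast
qed

lemma Ck_on_add:
  assumes "open S" "Ck_on k S f" "Ck_on k S g"
  shows "Ck_on k S (\<lambda>x. f x + g x)"
  using assms(2,3)
proof (induction k arbitrary: f g)
  case 0
  then show ?case by (auto intro: continuous_intros)
next
  case (Suc k)
  show ?case
    by (rule Ck_on_SucI[OF \<open>open S\<close> has_derivative_add[OF Ck_on_SucD[OF Suc.prems(1)] Ck_on_SucD[OF Suc.prems(2)]]])
      (use Suc in auto)
qed

lemma Ck_on_sum:
  assumes "open S" "finite I" "\<And>i. i \<in> I \<Longrightarrow> Ck_on k S (f i)"
  shows "Ck_on k S (\<lambda>x. \<Sum>i\<in>I. f i x)"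
  using assms(2,3)
  by (induction I rule: finite_induct) (auto intro: Ck_on_const Ck_on_add assms(1))

lemma Ck_on_scaleR:
  assumes "open S" "Ck_on k S f" "Ck_on k S g"
  shows "Ck_on k S (\<lambda>x. f x *\<^sub>R g x)"
  using assms(2,3)
proof (induction k arbitrary: f g)
  case 0
  then show ?case by (auto intro: continuous_intros)
next
  case (Suc k)
  show ?case
  proof (rule Ck_on_SucI[OF \<open>open S\<close> has_derivative_scaleR[OF Ck_on_SucD[OF Suc.prems(1)] Ck_on_SucD[OF Suc.prems(2)]]])
    fix v
    show "Ck_on k S (\<lambda>x. f x *\<^sub>R frechet_derivative g (at x) v + frechet_derivative f (at x) v *\<^sub>R g x)"
      using Suc.prems Ck_on_Suc_imp[OF Suc.prems(1)] Ck_on_Suc_imp[OF Suc.prems(2)]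
      by (intro Ck_on_add \<open>open S\<close> Suc.IH) auto
  qed
qed

text \<open>
The chain rule produces the outer derivative at \<open>f x\<close> applied to a vector depending on \<open>x\<close>. Expanding that
vector in the standard basis leaves products of partial derivatives of \<open>g\<close>, composed with \<open>f\<close>, and
components of the derivative of \<open>f\<close>, to which the induction hypothesis and the product rule apply.
\<close>

lemma Ck_on_compose:
  assumes "open S" "open T" "f ` S \<subseteq> T" "Ck_on k S f" "Ck_on k T g"
  shows "Ck_on k S (\<lambda>x. g (f x))"
  using assms(4,5)
proof (induction k arbitrary: g)
  case 0
  then show ?case using continuous_on_compose2[OF _ _ assms(3), of g] by simp
next
  case (Suc k)
  let ?f' = "\<lambda>x. frechet_derivative f (at x)" and ?g' = "\<lambda>y. frechet_derivative g (at y)"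
  show ?case
  proof (rule Ck_on_SucI[OF \<open>open S\<close>])
    fix x assume x: "x \<in> S"
    then have fx: "f x \<in> T" using assms(3) by auto
    have lin: "linear (?g' (f x))"
      by (rule has_derivative_linear[OF Ck_on_SucD[OF Suc.prems(2) fx]])
    have "((\<lambda>x. g (f x)) has_derivative (\<lambda>v. ?g' (f x) (?f' x v))) (at x)"
      by (rule has_derivative_compose[OF Ck_on_SucD[OF Suc.prems(1) x] Ck_on_SucD[OF Suc.prems(2) fx]])
    moreover have "(\<lambda>v. ?g' (f x) (?f' x v)) = (\<lambda>v. \<Sum>b\<in>Basis. (?f' x v \<bullet> b) *\<^sub>R ?g' (f x) b)"
    proof
      fix v
      have "?g' (f x) (?f' x v) = ?g' (f x) (\<Sum>b\<in>Basis. (?f' x v \<bullet> b) *\<^sub>R b)"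
        by (simp only: euclidean_representation)
      also have "\<dots> = (\<Sum>b\<in>Basis. (?f' x v \<bullet> b) *\<^sub>R ?g' (f x) b)"
        by (simp only: linear_sum[OF lin] linear_scale[OF lin])
      finally show "?g' (f x) (?f' x v) = (\<Sum>b\<in>Basis. (?f' x v \<bullet> b) *\<^sub>R ?g' (f x) b)" .
    qed
    ultimately show "((\<lambda>x. g (f x)) has_derivative
        (\<lambda>v. \<Sum>b\<in>Basis. (?f' x v \<bullet> b) *\<^sub>R ?g' (f x) b)) (at x)"
      by simp
  next
    fix v
    have "Ck_on k S (\<lambda>x. ?g' (f x) b)" for b
      by (rule Suc.IH[OF Ck_on_Suc_imp[OF Suc.prems(1)]]) (use Suc.prems(2) in simp)
    moreover have "Ck_on k S (\<lambda>x. ?f' x v \<bullet> b)" for b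
      by (rule Ck_on_linear_compose[OF bounded_linear_inner_left \<open>open S\<close>])
        (use Suc.prems(1) in simp)
    ultimately show "Ck_on k S (\<lambda>x. \<Sum>b\<in>Basis. (?f' x v \<bullet> b) *\<^sub>R ?g' (f x) b)"
      by (intro Ck_on_sum Ck_on_scaleR \<open>open S\<close>) auto
  qed
qed

lemma smooth_on_cong: "open S \<Longrightarrow> (\<And>x. x \<in> S \<Longrightarrow> f x = g x) \<Longrightarrow> smooth_on S f \<Longrightarrow> smooth_on S g"
  unfolding smooth_on_def using Ck_on_cong by blast

lemma smooth_on_subset: "smooth_on S f \<Longrightarrow> T \<subseteq> S \<Longrightarrow> smooth_on T f"
  unfolding smooth_on_def using Ck_on_subset by blast

lemma smooth_on_local:
  assumes "\<And>x. x \<in> S \<Longrightarrow> \<exists>T. open T \<and> x \<in> T \<and> smooth_on T f"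
  shows "smooth_on S f"
  using assms unfolding smooth_on_def by (meson Ck_on_local)

lemma smooth_on_const: "open S \<Longrightarrow> smooth_on S (\<lambda>x. c)"
  by (simp add: smooth_on_def Ck_on_const)

lemma smooth_on_linear: "bounded_linear L \<Longrightarrow> open S \<Longrightarrow> smooth_on S L"
  by (simp add: smooth_on_def Ck_on_linear)

lemma smooth_on_add:
  "open S \<Longrightarrow> smooth_on S f \<Longrightarrow> smooth_on S g \<Longrightarrow> smooth_on S (\<lambda>x. f x + g x)"
  by (simp add: smooth_on_def Ck_on_add)

lemma smooth_on_mult:
  fixes f g :: "'e::euclidean_space \<Rightarrow> real"
  shows "open S \<Longrightarrow> smooth_on S f \<Longrightarrow> smooth_on S g \<Longrightarrow> smooth_on S (\<lambda>x. f x * g x)"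
  using Ck_on_scaleR[of S _ f g] by (simp add: smooth_on_def)

lemma smooth_on_compose:
  "open S \<Longrightarrow> open T \<Longrightarrow> f ` S \<subseteq> T \<Longrightarrow> smooth_on S f \<Longrightarrow> smooth_on T g \<Longrightarrow> smooth_on S (\<lambda>x. g (f x))"
  unfolding smooth_on_def using Ck_on_compose by blast

lemma smooth_on_linear_compose:
  "bounded_linear L \<Longrightarrow> open S \<Longrightarrow> smooth_on S f \<Longrightarrow> smooth_on S (\<lambda>x. L (f x))"
  by (simp add: smooth_on_def Ck_on_linear_compose)

lemma smooth_on_Pair:
  assumes "open S" "smooth_on S f" "smooth_on S g"
  shows "smooth_on S (\<lambda>x. (f x, g x))"
proof -
  have "bounded_linear (\<lambda>a. (a, 0))" "bounded_linear (\<lambda>b. (0, b))"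
    by (intro bounded_linear_Pair bounded_linear_ident bounded_linear_zero)+
  then have "smooth_on S (\<lambda>x. (f x, 0) + (0, g x))"
    by (intro smooth_on_add smooth_on_linear_compose[of "\<lambda>a. (a, 0)"]
        smooth_on_linear_compose[of "\<lambda>b. (0, b)"] assms)
  then show ?thesis by simp
qed

lemma smooth_on_has_derivative:
  "smooth_on S f \<Longrightarrow> x \<in> S \<Longrightarrow> (f has_derivative frechet_derivative f (at x)) (at x)"
  unfolding smooth_on_def using Ck_on_SucD by blast

lemma smooth_on_frechet_derivative:
  "smooth_on S f \<Longrightarrow> smooth_on S (\<lambda>x. frechet_derivative f (at x) v)"
  unfolding smooth_on_def using Ck_on.simps(2) by blast

section \<open>Bump functions\<close>

text \<open>
The functions \<open>exp (- 1 / x) / x ^ n\<close>, extended by zero to \<open>x \<le> 0\<close>. As a family they are closed under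
differentiation up to linear combinations, which makes all of them smooth.
\<close>

definition flat :: "nat \<Rightarrow> real \<Rightarrow> real" where
  "flat n x = (if x > 0 then exp (- 1 / x) / x ^ n else 0)"

lemma flat_has_derivative:
  "(flat n has_real_derivative flat (n + 2) x - real n * flat (n + 1) x) (at x)"
proof -
  consider "x > 0" | "x < 0" | "x = 0" by linarith
  then show ?thesis
  proof cases
    case 1
    have pow: "((\<lambda>x. x ^ n) has_real_derivative real n * x ^ n / x) (at x)"
      using DERIV_pow[of n x] 1 by (cases n) auto
    have exp: "((\<lambda>x. exp (- 1 / x)) has_real_derivative exp (- 1 / x) / x\<^sup>2) (at x)"
      using 1 by (auto intro!: derivative_eq_intros simp: field_simps power2_eq_square)
    have "((\<lambda>x. exp (- 1 / x) / x ^ n) has_real_derivative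
        flat (n + 2) x - real n * flat (n + 1) x) (at x)"
      by (rule DERIV_cong[OF DERIV_divide[OF exp pow]])
        (use 1 in \<open>auto simp: flat_def field_simps power2_eq_square\<close>)
    then show ?thesis
      by (rule has_field_derivative_transform_within_open[of _ _ _ "{0<..}"]) (use 1 in \<open>auto simp: flat_def\<close>)
  next
    case 2
    have "((\<lambda>x. 0) has_real_derivative flat (n + 2) x - real n * flat (n + 1) x) (at x)"
      using 2 by (auto simp: flat_def)
    then show ?thesis
      by (rule has_field_derivative_transform_within_open[of _ _ _ "{..<0}"]) (use 2 in \<open>auto simp: flat_def\<close>)
  next
    case 3
    \<comment> \<open>The difference quotient of \<open>flat n\<close> at 0 is \<open>flat (n + 1)\<close> on the right.\<close>
    have lim: "((\<lambda>x::real. exp (- 1 / x) / x ^ (n + 1)) \<longlongrightarrow> 0) (at_right 0)"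
      by real_asymp
    have "((\<lambda>h. (flat n (0 + h) - flat n 0) / h) \<longlongrightarrow> 0) (at_right 0)"
      by (rule Lim_transform_eventually[OF lim])
         (auto simp: flat_def eventually_at_right_field intro!: exI[of _ 1])
    moreover have "((\<lambda>h. (flat n (0 + h) - flat n 0) / h) \<longlongrightarrow> 0) (at_left 0)"
      by (rule Lim_transform_eventually[OF tendsto_const])
         (auto simp: flat_def eventually_at_left_field intro!: exI[of _ "-1"])
    ultimately have "((\<lambda>h. (flat n (0 + h) - flat n 0) / h) \<longlongrightarrow> 0) (at 0)"
      by (simp add: filterlim_split_at)
    then show ?thesis using 3 by (simp add: DERIV_def flat_def)
  qed
qed

lemma smooth_on_flat: "smooth_on UNIV (flat n)"
proof -
  have "Ck_on k UNIV (flat n)" for k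
  proof (induction k arbitrary: n)
    case 0
    then show ?case
      by (auto intro!: continuous_at_imp_continuous_on DERIV_isCont[OF flat_has_derivative])
  next
    case (Suc k)
    show ?case
    proof (rule Ck_on_SucI[OF open_UNIV flat_has_derivative[unfolded has_field_derivative_def]])
      fix v
      have "Ck_on k UNIV (\<lambda>x. v *\<^sub>R (flat (n + 2) x + (- real n) *\<^sub>R flat (n + 1) x))"
        by (intro Ck_on_scaleR Ck_on_add Ck_on_const Suc.IH open_UNIV)
      then show "Ck_on k UNIV (\<lambda>x. (flat (n + 2) x - real n * flat (n + 1) x) * v)"
        by (simp add: algebra_simps)
    qed
  qed
  then show ?thesis by (simp add: smooth_on_def)
qed

text \<open>
The quotient \<open>flat 0 t / flat 0 1\<close> vanishes for \<open>t \<le> 0\<close> and is at least 1 for \<open>t \<ge> 1\<close>, so feeding one minus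
it to \<open>flat 0\<close> again gives plateaus on both sides.
\<close>

definition cutoff :: "real \<Rightarrow> real" where
  "cutoff t = flat 0 (1 - flat 0 t / flat 0 1) / flat 0 1"

lemma cutoff_eq_1: "t \<le> 0 \<Longrightarrow> cutoff t = 1"
  by (simp add: cutoff_def flat_def)

lemma cutoff_eq_0: "t \<ge> 1 \<Longrightarrow> cutoff t = 0"
  by (auto simp: cutoff_def flat_def)

lemma smooth_on_cutoff: "smooth_on UNIV cutoff"
proof -
  have *: "smooth_on UNIV (\<lambda>t. 1 + (- 1 / flat 0 1) * flat 0 t)"
    by (intro smooth_on_add smooth_on_mult smooth_on_const smooth_on_flat open_UNIV)
  have "smooth_on UNIV (\<lambda>t. flat 0 (1 + (- 1 / flat 0 1) * flat 0 t))"
    by (rule smooth_on_compose[OF _ _ _ * smooth_on_flat]) auto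
  then have "smooth_on UNIV (\<lambda>t. (1 / flat 0 1) * flat 0 (1 + (- 1 / flat 0 1) * flat 0 t))"
    by (intro smooth_on_mult smooth_on_const open_UNIV)
  moreover have "(\<lambda>t. (1 / flat 0 1) * flat 0 (1 + (- 1 / flat 0 1) * flat 0 t)) = cutoff"
    by (auto simp: cutoff_def)
  ultimately show ?thesis by simp
qed

lemma smooth_bump_euclidean:
  fixes a :: "'e::euclidean_space"
  assumes "r > 0"
  obtains \<beta> :: "'e \<Rightarrow> real" where "smooth_on UNIV \<beta>"
    "\<And>x. dist a x \<le> r \<Longrightarrow> \<beta> x = 1" "\<And>x. dist a x \<ge> 2 * r \<Longrightarrow> \<beta> x = 0"
proof
  \<comment> \<open>The squared distance from \<open>a\<close>, written as a polynomial in the coordinates.\<close>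
  define q where "q = (\<lambda>x::'e. (\<Sum>b\<in>Basis. ((x \<bullet> b) + - (a \<bullet> b)) * ((x \<bullet> b) + - (a \<bullet> b))))"
  have q: "q x = (dist a x)\<^sup>2" for x
    by (simp add: q_def dist_commute[of a x] dist_norm[of x a] power2_norm_eq_inner[of "x - a"]
        euclidean_inner[of "x - a" "x - a"] flip: inner_diff_left)
  let ?\<beta> = "\<lambda>x. cutoff ((1 / r\<^sup>2) * q x + (- 1))"
  have "smooth_on UNIV (\<lambda>x::'e. ((x \<bullet> b) + - (a \<bullet> b)) * ((x \<bullet> b) + - (a \<bullet> b)))" for b
    by (intro smooth_on_mult smooth_on_add smooth_on_const smooth_on_linear open_UNIV
        bounded_linear_inner_left)
  then have "smooth_on UNIV q"
    unfolding q_def smooth_on_def by (intro allI Ck_on_sum open_UNIV finite_Basis) blast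
  then have "smooth_on UNIV (\<lambda>x. (1 / r\<^sup>2) * q x + (- 1))"
    by (intro smooth_on_mult smooth_on_add smooth_on_const open_UNIV)
  from smooth_on_compose[OF _ _ _ this smooth_on_cutoff] show "smooth_on UNIV ?\<beta>"
    by simp
  fix x
  show "?\<beta> x = 1" if "dist a x \<le> r"
    using that assms power_mono[OF that, of 2] by (intro cutoff_eq_1) (simp add: q)
  show "?\<beta> x = 0" if "dist a x \<ge> 2 * r"
  proof (rule cutoff_eq_0)
    have "2 * r\<^sup>2 \<le> q x"
      using power_mono[OF that, of 2] assms by (simp add: q power_mult_distrib) (smt (verit) zero_le_power2)
    then show "1 \<le> 1 / r\<^sup>2 * q x + - 1" using assms by (simp add: pos_le_divide_eq)
  qed
qed

section \<open>Smooth functions on a manifold\<close>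

lemma atlas_chart_exists:
  assumes "smooth_atlas A"
  obtains U c where "(U, c) \<in> A" "p \<in> U"
proof -
  have "p \<in> (\<Union>(U, c)\<in>A. U)" using assms unfolding smooth_atlas_def by simp
  then show thesis using that by auto
qed

lemma chart_facts:
  assumes "smooth_atlas A" "(U, c) \<in> A"
  shows "open U" "open (c ` U)" "homeomorphism U (c ` U) c (inv_into U c)"
proof -
  have "\<forall>(U, c)\<in>A. open U \<and> open (c ` U) \<and> homeomorphism U (c ` U) c (inv_into U c)"
    using assms(1) unfolding smooth_atlas_def by (elim conjE)
  from bspec[OF this assms(2)]
  show "open U" "open (c ` U)" "homeomorphism U (c ` U) c (inv_into U c)" by simp_all
qed

lemma chart_inverse:
  assumes "smooth_atlas A" "(U, c) \<in> A"
  shows "p \<in> U \<Longrightarrow> inv_into U c (c p) = p" "x \<in> c ` U \<Longrightarrow> inv_into U c x \<in> U"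
    "x \<in> c ` U \<Longrightarrow> c (inv_into U c x) = x"
  using chart_facts(3)[OF assms] by (auto simp: homeomorphism_def inv_into_into)

lemma chart_open_image:
  assumes "smooth_atlas A" "(U, c) \<in> A" "open W" "W \<subseteq> U"
  shows "open (c ` W)"
proof -
  have "openin (top_of_set U) W" using assms(3,4) by (simp add: open_subset)
  then show ?thesis
    using homeomorphism_imp_open_map[OF chart_facts(3)[OF assms(1,2)]] chart_facts(2)[OF assms(1,2)]
      openin_open_trans by blast
qed

lemma transition_smooth:
  assumes "smooth_atlas A" "(U, c) \<in> A" "(V, d) \<in> A"
  shows "smooth_on (c ` (U \<inter> V)) (d \<circ> inv_into U c)"
proof -
  have "\<forall>(U, c)\<in>A. \<forall>(V, d)\<in>A. smooth_on (c ` (U \<inter> V)) (d \<circ> inv_into U c)"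
    using assms(1) unfolding smooth_atlas_def by (elim conjE)
  from bspec[OF this assms(2)] show ?thesis using assms(3) by auto
qed

lemma smooth_funs_chart:
  "f \<in> smooth_funs A \<Longrightarrow> (U, c) \<in> A \<Longrightarrow> smooth_on (c ` U) (f \<circ> inv_into U c)"
  unfolding smooth_funs_def by blast

text \<open>
Transition maps are smooth, so near each point smoothness may be tested in a single chart.
\<close>

lemma smooth_funs_localI:
  assumes A: "smooth_atlas A"
    and loc: "\<And>p. \<exists>U c W. (U, c) \<in> A \<and> open W \<and> p \<in> W \<and> W \<subseteq> U \<and> smooth_on (c ` W) (f \<circ> inv_into U c)"
  shows "f \<in> smooth_funs A"
  unfolding smooth_funs_def
proof clarify
  fix U c assume Uc: "(U, c) \<in> A"
  show "smooth_on (c ` U) (f \<circ> inv_into U c)"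
  proof (rule smooth_on_local)
    fix x assume "x \<in> c ` U"
    then obtain p where p: "p \<in> U" "x = c p" by blast
    obtain V d W where W: "(V, d) \<in> A" "open W" "p \<in> W" "W \<subseteq> V" "smooth_on (d ` W) (f \<circ> inv_into V d)"
      using loc by blast
    let ?T = "c ` (U \<inter> W)"
    have opT: "open ?T"
      using chart_open_image[OF A Uc] W(2) chart_facts(1)[OF A Uc] by (simp add: open_Int)
    have "smooth_on ?T (\<lambda>x. (f \<circ> inv_into V d) ((d \<circ> inv_into U c) x))"
    proof (rule smooth_on_compose[OF opT chart_open_image[OF A W(1,2,4)]])
      show "(d \<circ> inv_into U c) ` ?T \<subseteq> d ` W"
        using chart_inverse(1)[OF A Uc] by auto
      show "smooth_on ?T (d \<circ> inv_into U c)"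
        using W(4) by (intro smooth_on_subset[OF transition_smooth[OF A Uc W(1)]]) auto
    qed (rule W(5))
    then have "smooth_on ?T (f \<circ> inv_into U c)"
      by (rule smooth_on_cong[OF opT, rotated])
        (use chart_inverse(1)[OF A Uc] chart_inverse(1)[OF A W(1)] W(4) in auto)
    then show "\<exists>T. open T \<and> x \<in> T \<and> smooth_on T (f \<circ> inv_into U c)"
      using opT p W(3) by blast
  qed
qed

lemma smooth_funs_local_eqI:
  assumes A: "smooth_atlas A"
    and loc: "\<And>p. \<exists>W f'. open W \<and> p \<in> W \<and> f' \<in> smooth_funs A \<and> (\<forall>q\<in>W. f q = f' q)"
  shows "f \<in> smooth_funs A"
proof (rule smooth_funs_localI[OF A])
  fix p
  obtain W f' where W: "open W" "p \<in> W" "f' \<in> smooth_funs A" "\<forall>q\<in>W. f q = f' q" using loc by blast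
  obtain U c where Uc: "(U, c) \<in> A" "p \<in> U" by (rule atlas_chart_exists[OF A])
  have opW: "open (U \<inter> W)" using chart_facts(1)[OF A Uc(1)] W by auto
  have op: "open (c ` (U \<inter> W))" by (rule chart_open_image[OF A Uc(1) opW]) auto
  have "smooth_on (c ` (U \<inter> W)) (f' \<circ> inv_into U c)"
    by (rule smooth_on_subset[OF smooth_funs_chart[OF W(3) Uc(1)]]) auto
  then have "smooth_on (c ` (U \<inter> W)) (f \<circ> inv_into U c)"
    by (rule smooth_on_cong[OF op, rotated]) (use W(4) chart_inverse(1)[OF A Uc(1)] in auto)
  then show "\<exists>U c W. (U, c) \<in> A \<and> open W \<and> p \<in> W \<and> W \<subseteq> U \<and> smooth_on (c ` W) (f \<circ> inv_into U c)"
    using Uc W opW by blast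
qed

lemma smooth_funsI:
  "(\<And>U c. (U, c) \<in> A \<Longrightarrow> smooth_on (c ` U) (\<lambda>x. f (inv_into U c x))) \<Longrightarrow> f \<in> smooth_funs A"
  unfolding smooth_funs_def comp_def by blast

lemma smooth_funsD:
  "f \<in> smooth_funs A \<Longrightarrow> (U, c) \<in> A \<Longrightarrow> smooth_on (c ` U) (\<lambda>x. f (inv_into U c x))"
  unfolding smooth_funs_def comp_def by blast

lemma smooth_funs_const: "smooth_atlas A \<Longrightarrow> (\<lambda>p. k) \<in> smooth_funs A"
  by (rule smooth_funsI) (rule smooth_on_const[OF chart_facts(2)])

lemma smooth_funs_add:
  assumes "smooth_atlas A" "f \<in> smooth_funs A" "g \<in> smooth_funs A"
  shows "(\<lambda>p. f p + g p) \<in> smooth_funs A"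
  by (rule smooth_funsI) (rule smooth_on_add[OF chart_facts(2)[OF assms(1)] smooth_funsD[OF assms(2)] smooth_funsD[OF assms(3)]])

lemma smooth_funs_mult:
  assumes "smooth_atlas A" "f \<in> smooth_funs A" "g \<in> smooth_funs A"
  shows "(\<lambda>p. f p * g p) \<in> smooth_funs A"
  by (rule smooth_funsI) (rule smooth_on_mult[OF chart_facts(2)[OF assms(1)] smooth_funsD[OF assms(2)] smooth_funsD[OF assms(3)]])

lemma smooth_funs_sum:
  assumes "smooth_atlas A" "finite I" "\<And>i. i \<in> I \<Longrightarrow> f i \<in> smooth_funs A"
  shows "(\<lambda>p. \<Sum>i\<in>I. f i p) \<in> smooth_funs A"
  using assms(2,3)
  by (induction I rule: finite_induct) (auto intro: smooth_funs_const smooth_funs_add assms(1))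

lemma smooth_map_continuous: "smooth_map A B F \<Longrightarrow> continuous_on UNIV F"
  by (simp add: smooth_map_def)

lemma smooth_map_ident: "smooth_atlas A \<Longrightarrow> smooth_map A A (\<lambda>p. p)"
  using transition_smooth[of A] unfolding smooth_map_def by (auto simp: comp_def)

lemma smooth_funs_compose:
  assumes A: "smooth_atlas A" and B: "smooth_atlas B" and F: "smooth_map A B F" and f: "f \<in> smooth_funs B"
  shows "(\<lambda>p. f (F p)) \<in> smooth_funs A"
proof (rule smooth_funs_localI[OF A])
  fix p
  obtain U c where Uc: "(U, c) \<in> A" "p \<in> U" by (rule atlas_chart_exists[OF A])
  obtain V d where Vd: "(V, d) \<in> B" "F p \<in> V" by (rule atlas_chart_exists[OF B])
  let ?W = "U \<inter> F -` V"
  have opW: "open ?W"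
    using F chart_facts(1)[OF A Uc(1)] chart_facts(1)[OF B Vd(1)]
    by (auto simp: smooth_map_def intro!: open_vimage)
  have opT: "open (c ` ?W)" using chart_open_image[OF A Uc(1) opW] by simp
  have "smooth_on (c ` ?W) (\<lambda>x. (f \<circ> inv_into V d) ((d \<circ> F \<circ> inv_into U c) x))"
  proof (rule smooth_on_compose[OF opT chart_facts(2)[OF B Vd(1)]])
    show "(d \<circ> F \<circ> inv_into U c) ` c ` ?W \<subseteq> d ` V" using chart_inverse(1)[OF A Uc(1)] by auto
    show "smooth_on (c ` ?W) (d \<circ> F \<circ> inv_into U c)" using F Uc Vd unfolding smooth_map_def by blast
    show "smooth_on (d ` V) (f \<circ> inv_into V d)" using f Vd smooth_funs_chart by blast
  qed
  then have "smooth_on (c ` ?W) ((\<lambda>p. f (F p)) \<circ> inv_into U c)"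
    by (rule smooth_on_cong[OF opT, rotated])
      (use chart_inverse(1)[OF A Uc(1)] chart_inverse(1)[OF B Vd(1)] in auto)
  then show "\<exists>U c W. (U, c) \<in> A \<and> open W \<and> p \<in> W \<and> W \<subseteq> U \<and> smooth_on (c ` W) ((\<lambda>p. f (F p)) \<circ> inv_into U c)"
    using Uc Vd opW by blast
qed

text \<open>
The space is Hausdorff, so the preimage \<open>K\<close> of a closed coordinate ball, being compact, is closed; hence
the extension of a coordinate bump function by zero is smooth. That the support lies in a closed set \<open>K\<close>,
and not only in \<open>G\<close>, is what allows cutting off functions defined on \<open>G\<close> alone.
\<close>

lemma smooth_bump:
  assumes A: "smooth_atlas (A :: ('a::{t2_space,second_countable_topology}, 'e::euclidean_space) chart set)"
    and G: "open G" "p \<in> G"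
  obtains \<rho> K W where "\<rho> \<in> smooth_funs A" "closed K" "K \<subseteq> G" "\<And>q. q \<notin> K \<Longrightarrow> \<rho> q = 0"
    "open W" "p \<in> W" "\<And>q. q \<in> W \<Longrightarrow> \<rho> q = 1"
proof -
  obtain U c where Uc: "(U, c) \<in> A" "p \<in> U" by (rule atlas_chart_exists[OF A])
  have opU: "open U" by (rule chart_facts(1)[OF A Uc(1)])
  have hom: "continuous_on U c" "continuous_on (c ` U) (inv_into U c)"
    using chart_facts(3)[OF A Uc(1)] by (auto simp: homeomorphism_def)
  have "open (c ` (U \<inter> G))" "c p \<in> c ` (U \<inter> G)"
    using chart_open_image[OF A Uc(1)] opU G Uc by auto
  then obtain e where e: "e > 0" "cball (c p) e \<subseteq> c ` (U \<inter> G)"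
    by (meson open_contains_cball)
  obtain \<beta> :: "'e \<Rightarrow> real" where \<beta>: "smooth_on UNIV \<beta>"
    "\<And>x. dist (c p) x \<le> e / 2 \<Longrightarrow> \<beta> x = 1" "\<And>x. dist (c p) x \<ge> 2 * (e / 2) \<Longrightarrow> \<beta> x = 0"
    using smooth_bump_euclidean[of "e / 2" "c p"] e by auto
  define \<rho> where "\<rho> = (\<lambda>q. if q \<in> U then \<beta> (c q) else 0)"
  define K where "K = inv_into U c ` cball (c p) e"
  define W where "W = U \<inter> c -` ball (c p) (e / 2)"
  have KU: "K \<subseteq> U \<inter> G"
    unfolding K_def using e(2) chart_inverse(1)[OF A Uc(1)] by force
  have clK: "closed K"
    unfolding K_def using e(2)
    by (intro compact_imp_closed compact_continuous_image continuous_on_subset[OF hom(2)]) auto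
  have off: "\<rho> q = 0" if "q \<notin> K" for q
  proof (cases "q \<in> U")
    case True
    then have "c q \<notin> cball (c p) e"
      using that chart_inverse(1)[OF A Uc(1)] unfolding K_def by force
    then show ?thesis using \<beta>(3) by (simp add: \<rho>_def)
  qed (simp add: \<rho>_def)
  show thesis
  proof (rule that[of \<rho> K W])
    show "\<rho> \<in> smooth_funs A"
    proof (rule smooth_funs_localI[OF A])
      fix q
      show "\<exists>U c W. (U, c) \<in> A \<and> open W \<and> q \<in> W \<and> W \<subseteq> U \<and> smooth_on (c ` W) (\<rho> \<circ> inv_into U c)"
      proof (cases "q \<in> U")
        case True
        have "smooth_on (c ` U) (\<rho> \<circ> inv_into U c)"
          by (rule smooth_on_cong[OF _ _ smooth_on_subset[OF \<beta>(1)]])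
            (use chart_inverse[OF A Uc(1)] chart_facts(2)[OF A Uc(1)] in \<open>auto simp: \<rho>_def\<close>)
        then show ?thesis using Uc(1) True opU by blast
      next
        case False
        obtain V d where Vd: "(V, d) \<in> A" "q \<in> V" by (rule atlas_chart_exists[OF A])
        have opVK: "open (V - K)" using chart_facts(1)[OF A Vd(1)] clK by auto
        then have opd: "open (d ` (V - K))" using chart_open_image[OF A Vd(1)] by auto
        have "smooth_on (d ` (V - K)) (\<rho> \<circ> inv_into V d)"
          by (rule smooth_on_cong[OF opd _ smooth_on_const[OF opd, of 0]])
            (use chart_inverse(1)[OF A Vd(1)] off in auto)
        moreover have "q \<in> V - K" using False Vd KU by blast
        ultimately show ?thesis using Vd opVK by blast
      qed
    qed
    show "open W" unfolding W_def using continuous_open_preimage[OF hom(1) opU] by auto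
    show "p \<in> W" unfolding W_def using Uc e by auto
    show "\<rho> q = 1" if "q \<in> W" for q using that \<beta>(2) unfolding W_def \<rho>_def by auto
  qed (use KU clK off in auto)
qed

text \<open>
The values of \<open>h\<close> outside the chart are arbitrary, since \<open>\<rho>\<close> vanishes on the open complement of \<open>K\<close>.
\<close>

lemma smooth_funs_cutoff_mult:
  assumes A: "smooth_atlas A" and Uc: "(U, c) \<in> A" and \<rho>: "\<rho> \<in> smooth_funs A"
    and K: "closed K" "K \<subseteq> U" "\<And>q. q \<notin> K \<Longrightarrow> \<rho> q = 0"
    and h: "smooth_on (c ` U) (h \<circ> inv_into U c)"
  shows "(\<lambda>q. \<rho> q * h q) \<in> smooth_funs A"
proof (rule smooth_funs_localI[OF A])
  fix q
  show "\<exists>U c W. (U, c) \<in> A \<and> open W \<and> q \<in> W \<and> W \<subseteq> U \<and> smooth_on (c ` W) ((\<lambda>q. \<rho> q * h q) \<circ> inv_into U c)"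
  proof (cases "q \<in> U")
    case True
    have "smooth_on (c ` U) (\<lambda>x. (\<rho> \<circ> inv_into U c) x * (h \<circ> inv_into U c) x)"
      using smooth_funs_chart[OF \<rho> Uc] h chart_facts(2)[OF A Uc] by (intro smooth_on_mult)
    then show ?thesis using Uc True chart_facts(1)[OF A Uc] by (force simp: comp_def)
  next
    case False
    obtain V d where Vd: "(V, d) \<in> A" "q \<in> V" by (rule atlas_chart_exists[OF A])
    have opVK: "open (V - K)" using chart_facts(1)[OF A Vd(1)] K by auto
    then have opd: "open (d ` (V - K))" using chart_open_image[OF A Vd(1)] by auto
    have "smooth_on (d ` (V - K)) ((\<lambda>q. \<rho> q * h q) \<circ> inv_into V d)"
      by (rule smooth_on_cong[OF opd _ smooth_on_const[OF opd, of 0]])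
        (use chart_inverse(1)[OF A Vd(1)] K(3) in auto)
    moreover have "q \<in> V - K" using False Vd K by blast
    ultimately show ?thesis using Vd opVK by blast
  qed
qed

section \<open>Tangent vectors\<close>

lemma smooth_funs_chart_derivative:
  assumes "smooth_atlas A" "(U, c) \<in> A" "p \<in> U" "f \<in> smooth_funs A"
  shows "(f \<circ> inv_into U c has_derivative frechet_derivative (f \<circ> inv_into U c) (at (c p))) (at (c p))"
  using smooth_on_has_derivative[OF smooth_funs_chart[OF assms(4,2)]] assms(3) by auto

lemma coord_vector_eqI:
  assumes "f \<in> smooth_funs A" "(f \<circ> inv_into U c has_derivative f') (at (c p))"
  shows "coord_vector A (U, c) p w f = f' w"
  using assms frechet_derivative_at[OF assms(2)] by (simp add: coord_vector_def)

text \<open>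
The chain rule in coordinates. For \<open>F\<close> the identity it is the change of charts for tangent vectors.
\<close>

lemma differential_coord_vector:
  assumes A: "smooth_atlas A" and B: "smooth_atlas B" and F: "smooth_map A B F"
    and Uc: "(U, c) \<in> A" "p \<in> U" and Vd: "(V, d) \<in> B" "F p \<in> V"
  shows "differential B F (coord_vector A (U, c) p w) =
    coord_vector B (V, d) (F p) (frechet_derivative (d \<circ> F \<circ> inv_into U c) (at (c p)) w)"
proof
  fix f
  show "differential B F (coord_vector A (U, c) p w) f =
    coord_vector B (V, d) (F p) (frechet_derivative (d \<circ> F \<circ> inv_into U c) (at (c p)) w) f"
  proof (cases "f \<in> smooth_funs B")
    case True
    let ?W = "U \<inter> F -` V" and ?\<Phi> = "d \<circ> F \<circ> inv_into U c"
    let ?D = "\<lambda>w. frechet_derivative (f \<circ> inv_into V d) (at (d (F p))) (frechet_derivative ?\<Phi> (at (c p)) w)"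
    have opW: "open ?W"
      using F chart_facts(1)[OF A Uc(1)] chart_facts(1)[OF B Vd(1)]
      by (auto simp: smooth_map_def intro!: open_vimage)
    have opT: "open (c ` ?W)" using chart_open_image[OF A Uc(1) opW] by simp
    have \<Phi>p: "?\<Phi> (c p) = d (F p)" using chart_inverse(1)[OF A Uc(1)] Uc by simp
    have "smooth_on (c ` ?W) ?\<Phi>" using F Uc Vd unfolding smooth_map_def by blast
    then have 1: "(?\<Phi> has_derivative frechet_derivative ?\<Phi> (at (c p))) (at (c p))"
      by (rule smooth_on_has_derivative) (use Uc Vd in auto)
    have 2: "(f \<circ> inv_into V d has_derivative frechet_derivative (f \<circ> inv_into V d) (at (d (F p)))) (at (?\<Phi> (c p)))"
      unfolding \<Phi>p by (rule smooth_funs_chart_derivative[OF B Vd True])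
    have "((\<lambda>x. (f \<circ> inv_into V d) (?\<Phi> x)) has_derivative ?D) (at (c p))"
      by (rule has_derivative_compose[OF 1 2])
    then have 3: "((\<lambda>p. f (F p)) \<circ> inv_into U c has_derivative ?D) (at (c p))"
      by (rule has_derivative_transform_within_open[OF _ opT])
        (use chart_inverse(1)[OF A Uc(1)] chart_inverse(1)[OF B Vd(1)] Uc Vd in auto)
    have "differential B F (coord_vector A (U, c) p w) f = coord_vector A (U, c) p w (\<lambda>p. f (F p))"
      by (simp add: differential_def True comp_def)
    also have "\<dots> = ?D w"
      by (rule coord_vector_eqI[OF smooth_funs_compose[OF A B F True] 3])
    finally show ?thesis by (simp add: coord_vector_def True)
  qed (simp add: differential_def coord_vector_def)
qed

lemma tangent_nonsmooth: "v \<in> tangent_space A p \<Longrightarrow> f \<notin> smooth_funs A \<Longrightarrow> v f = 0"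
  by (auto simp: tangent_space_def coord_vector_def)

lemma differential_ident: "v \<in> tangent_space A p \<Longrightarrow> differential A (\<lambda>p. p) v = v"
  using tangent_nonsmooth by (fastforce simp: differential_def comp_def)

text \<open>
The definition of \<open>tangent_space\<close> admits all charts around \<open>p\<close>; by the change of charts one of them
suffices, which gives the linear structure.
\<close>

lemma tangent_space_chart:
  assumes A: "smooth_atlas A" and Vd: "(V, d) \<in> A" "p \<in> V"
  shows "tangent_space A p = range (coord_vector A (V, d) p)"
proof (intro equalityI subsetI)
  fix v assume v: "v \<in> tangent_space A p"
  then obtain U c w where Uc: "(U, c) \<in> A" "p \<in> U" and w: "v = coord_vector A (U, c) p w"
    by (auto simp: tangent_space_def)
  have "differential A (\<lambda>p. p) v \<in> range (coord_vector A (V, d) p)"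
    unfolding w using differential_coord_vector[OF A A smooth_map_ident[OF A] Uc Vd, of w] by blast
  then show "v \<in> range (coord_vector A (V, d) p)" using differential_ident[OF v] by simp
qed (use Vd in \<open>auto simp: tangent_space_def\<close>)

lemma differential_tangent:
  assumes A: "smooth_atlas A" and B: "smooth_atlas B" and F: "smooth_map A B F" and v: "v \<in> tangent_space A p"
  shows "differential B F v \<in> tangent_space B (F p)"
proof -
  obtain U c w where Uc: "(U, c) \<in> A" "p \<in> U" and w: "v = coord_vector A (U, c) p w"
    using v by (auto simp: tangent_space_def)
  obtain V d where Vd: "(V, d) \<in> B" "F p \<in> V" by (rule atlas_chart_exists[OF B])
  show ?thesis
    unfolding w differential_coord_vector[OF A B F Uc Vd] tangent_space_chart[OF B Vd] by blast
qed

lemma coord_vector_lincomb: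
  assumes "smooth_atlas A" "(U, c) \<in> A" "p \<in> U"
  shows "lincomb a (coord_vector A (U, c) p u) b (coord_vector A (U, c) p w) =
    coord_vector A (U, c) p (a *\<^sub>R u + b *\<^sub>R w)"
proof
  fix f
  show "lincomb a (coord_vector A (U, c) p u) b (coord_vector A (U, c) p w) f =
    coord_vector A (U, c) p (a *\<^sub>R u + b *\<^sub>R w) f"
  proof (cases "f \<in> smooth_funs A")
    case True
    have "linear (frechet_derivative (f \<circ> inv_into U c) (at (c p)))"
      using smooth_funs_chart_derivative[OF assms True] by (rule has_derivative_linear)
    then show ?thesis
      using True by (simp add: lincomb_def coord_vector_def linear_add linear_scale)
  qed (simp add: lincomb_def coord_vector_def)
qed

lemma coord_vector_zero:
  assumes "smooth_atlas A" "(U, c) \<in> A" "p \<in> U"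
  shows "coord_vector A (U, c) p 0 = zero_vector"
  using coord_vector_lincomb[OF assms, of 0 0 0 0] by (simp add: lincomb_def zero_vector_def)

lemma tangent_lincomb:
  assumes A: "smooth_atlas A" and "u \<in> tangent_space A p" "v \<in> tangent_space A p"
  shows "lincomb a u b v \<in> tangent_space A p"
proof -
  obtain U c where Uc: "(U, c) \<in> A" "p \<in> U" by (rule atlas_chart_exists[OF A])
  show ?thesis
    using assms(2,3) unfolding tangent_space_chart[OF A Uc] by (auto simp: coord_vector_lincomb[OF A Uc])
qed

lemma tangent_space_nonempty: "smooth_atlas A \<Longrightarrow> \<exists>v. v \<in> tangent_space A p"
  by (rule atlas_chart_exists[of A p]) (auto simp: tangent_space_def)

lemma tangent_zero: "smooth_atlas A \<Longrightarrow> zero_vector \<in> tangent_space A p"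
  using tangent_lincomb[of A _ p _ 0 0] tangent_space_nonempty[of A p]
  by (fastforce simp: lincomb_def zero_vector_def)

lemma tangent_scale: "smooth_atlas A \<Longrightarrow> v \<in> tangent_space A p \<Longrightarrow> (\<lambda>f. a * v f) \<in> tangent_space A p"
  using tangent_lincomb[of A v p v a 0] by (simp add: lincomb_def)

lemma tangent_sum:
  assumes "smooth_atlas A" "finite I" "\<And>i. i \<in> I \<Longrightarrow> v i \<in> tangent_space A p"
  shows "(\<lambda>f. \<Sum>i\<in>I. a i * v i f) \<in> tangent_space A p"
  using assms(2,3)
proof (induction I rule: finite_induct)
  case empty
  then show ?case using tangent_zero[OF assms(1)] by (simp add: zero_vector_def)
next
  case (insert i I)
  then show ?case
    using tangent_lincomb[OF assms(1), of "v i" p _ "a i" 1] by (simp add: lincomb_def)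
qed

lemma tangent_fun_const:
  assumes A: "smooth_atlas A" and v: "v \<in> tangent_space A p"
  shows "v (\<lambda>q. k) = 0"
proof -
  obtain U c w where w: "v = coord_vector A (U, c) p w"
    using v by (auto simp: tangent_space_def)
  show ?thesis
    unfolding w using has_derivative_const[of k "at (c p)"]
    by (subst coord_vector_eqI[OF smooth_funs_const[OF A]]) (auto simp: comp_def)
qed

lemma
  assumes A: "smooth_atlas A" and v: "v \<in> tangent_space A p"
    and f: "f \<in> smooth_funs A" and g: "g \<in> smooth_funs A"
  shows tangent_fun_add: "v (\<lambda>q. f q + g q) = v f + v g"
    and tangent_fun_mult: "v (\<lambda>q. f q * g q) = v f * g p + f p * v g"
proof -
  obtain U c w where Uc: "(U, c) \<in> A" "p \<in> U" and w: "v = coord_vector A (U, c) p w"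
    using v by (auto simp: tangent_space_def)
  note fd = smooth_funs_chart_derivative[OF A Uc f] and gd = smooth_funs_chart_derivative[OF A Uc g]
  have vf: "v f = frechet_derivative (f \<circ> inv_into U c) (at (c p)) w"
    and vg: "v g = frechet_derivative (g \<circ> inv_into U c) (at (c p)) w"
    unfolding w by (auto simp: coord_vector_def f g)
  have p: "inv_into U c (c p) = p" by (rule chart_inverse(1)[OF A Uc])
  show "v (\<lambda>q. f q + g q) = v f + v g"
    unfolding vf vg unfolding w using has_derivative_add[OF fd gd]
    by (intro coord_vector_eqI smooth_funs_add A f g) (simp add: comp_def)
  show "v (\<lambda>q. f q * g q) = v f * g p + f p * v g"
    unfolding vf vg unfolding w using has_derivative_mult[OF fd gd]
    by (subst coord_vector_eqI[OF smooth_funs_mult[OF A f g]]) (auto simp: comp_def p add.commute)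
qed

lemma tangent_fun_cmult:
  "smooth_atlas A \<Longrightarrow> v \<in> tangent_space A p \<Longrightarrow> f \<in> smooth_funs A \<Longrightarrow> v (\<lambda>q. k * f q) = k * v f"
  using tangent_fun_mult[of A v p "\<lambda>q. k" f] tangent_fun_const[of A v p k] smooth_funs_const[of A k]
  by simp

lemma tangent_fun_sum:
  assumes "smooth_atlas A" "v \<in> tangent_space A p" "finite I" "\<And>i. i \<in> I \<Longrightarrow> f i \<in> smooth_funs A"
  shows "v (\<lambda>q. \<Sum>i\<in>I. f i q) = (\<Sum>i\<in>I. v (f i))"
  using assms(3,4)
proof (induction I rule: finite_induct)
  case empty
  then show ?case
    using tangent_fun_const[OF assms(1,2)] by simp
next
  case (insert i I)
  then show ?case
    using tangent_fun_add[OF assms(1,2), of "f i" "\<lambda>q. \<Sum>i\<in>I. f i q"]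
      smooth_funs_sum[OF assms(1) insert.hyps(1), of f] insert by simp
qed

lemma tangent_local:
  assumes A: "smooth_atlas A" and v: "v \<in> tangent_space A p"
    and f: "f \<in> smooth_funs A" and g: "g \<in> smooth_funs A"
    and W: "open W" "p \<in> W" "\<And>q. q \<in> W \<Longrightarrow> f q = g q"
  shows "v f = v g"
proof -
  obtain U c w where Uc: "(U, c) \<in> A" "p \<in> U" and w: "v = coord_vector A (U, c) p w"
    using v by (auto simp: tangent_space_def)
  have op: "open (c ` (U \<inter> W))"
    using chart_open_image[OF A Uc(1)] W(1) chart_facts(1)[OF A Uc(1)] by (simp add: open_Int)
  have eq: "(g \<circ> inv_into U c) x = (f \<circ> inv_into U c) x" if "x \<in> c ` (U \<inter> W)" for x
    using that W(3) chart_inverse(1)[OF A Uc(1)] by auto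
  have "(f \<circ> inv_into U c has_derivative frechet_derivative (g \<circ> inv_into U c) (at (c p))) (at (c p))"
    by (rule has_derivative_transform_within_open[OF smooth_funs_chart_derivative[OF A Uc g] op _ eq])
      (use Uc W(2) in auto)
  then show ?thesis
    unfolding w using coord_vector_eqI[OF f] g by (simp add: coord_vector_def)
qed

lemma differential_lincomb:
  "differential B F (lincomb a u b v) = lincomb a (differential B F u) b (differential B F v)"
  by (auto simp: differential_def lincomb_def)

lemma differential_scale: "differential B F (\<lambda>f. a * v f) = (\<lambda>f. a * differential B F v f)"
  by (auto simp: differential_def)

section \<open>Vector fields and local frames\<close>

lemma field_tangent: "V \<in> fields_along A B F \<Longrightarrow> V p \<in> tangent_space B (F p)"
  by (simp add: fields_along_def)

lemma field_smooth: "V \<in> fields_along A B F \<Longrightarrow> f \<in> smooth_funs B \<Longrightarrow> (\<lambda>p. V p f) \<in> smooth_funs A"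
  by (simp add: fields_along_def)

lemma field_along_differential:
  assumes "smooth_atlas A" "smooth_atlas B" "smooth_map A B F" "X \<in> vector_fields A"
  shows "(\<lambda>p. differential B F (X p)) \<in> fields_along A B F"
  using differential_tangent[OF assms(1-3)] field_tangent[OF assms(4)]
    field_smooth[OF assms(4) smooth_funs_compose[OF assms(1-3)]]
  by (auto simp: fields_along_def differential_def comp_def)

lemma field_along_restrict:
  assumes "smooth_atlas A" "smooth_atlas B" "smooth_map A B F" "Y \<in> vector_fields B"
  shows "(\<lambda>p. Y (F p)) \<in> fields_along A B F"
  using smooth_funs_compose[OF assms(1-3)] assms(4) by (auto simp: fields_along_def)

lemma field_scale:
  assumes "smooth_atlas A" "smooth_atlas B" "V \<in> fields_along A B F" "a \<in> smooth_funs A"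
  shows "(\<lambda>p f. a p * V p f) \<in> fields_along A B F"
  using assms tangent_scale[OF assms(2)] smooth_funs_mult[OF assms(1)] by (auto simp: fields_along_def)

lemma field_lincomb:
  assumes "smooth_atlas A" "smooth_atlas B" "V \<in> fields_along A B F" "W \<in> fields_along A B F"
    "a \<in> smooth_funs A" "b \<in> smooth_funs A"
  shows "(\<lambda>p. lincomb (a p) (V p) (b p) (W p)) \<in> fields_along A B F"
  using assms tangent_lincomb[OF assms(2)] smooth_funs_mult[OF assms(1)] smooth_funs_add[OF assms(1)]
  by (auto simp: fields_along_def lincomb_def)

lemma field_zero: "smooth_atlas A \<Longrightarrow> smooth_atlas B \<Longrightarrow> (\<lambda>p f. 0) \<in> fields_along A B F"
  using tangent_zero[of B] smooth_funs_const[of A] by (auto simp: fields_along_def zero_vector_def)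

lemma field_sum:
  assumes "smooth_atlas A" "smooth_atlas B" "finite I"
    "\<And>i. i \<in> I \<Longrightarrow> V i \<in> fields_along A B F" "\<And>i. i \<in> I \<Longrightarrow> a i \<in> smooth_funs A"
  shows "(\<lambda>p f. \<Sum>i\<in>I. a i p * V i p f) \<in> fields_along A B F"
  using assms tangent_sum[OF assms(2,3)]
  by (auto simp: fields_along_def intro!: smooth_funs_sum[OF assms(1,3)] smooth_funs_mult[OF assms(1)])

text \<open>
The coordinate field of a constant vector \<open>w\<close>, made global by a cutoff function.
\<close>

lemma chart_field:
  assumes A: "smooth_atlas A" and Uc: "(U, c) \<in> A" and \<rho>: "\<rho> \<in> smooth_funs A"
    and K: "closed K" "K \<subseteq> U" "\<And>q. q \<notin> K \<Longrightarrow> \<rho> q = 0"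
  shows "(\<lambda>q f. \<rho> q * coord_vector A (U, c) q w f) \<in> vector_fields A"
  unfolding fields_along_def
proof (intro CollectI conjI allI ballI)
  fix q
  show "(\<lambda>f. \<rho> q * coord_vector A (U, c) q w f) \<in> tangent_space A q"
  proof (cases "q \<in> U")
    case True
    then show ?thesis using Uc by (intro tangent_scale[OF A]) (auto simp: tangent_space_def)
  next
    case False
    then have "\<rho> q = 0" using K by blast
    then show ?thesis using tangent_zero[OF A] by (simp add: zero_vector_def)
  qed
next
  fix f assume f: "f \<in> smooth_funs A"
  have "smooth_on (c ` U) ((\<lambda>q. coord_vector A (U, c) q w f) \<circ> inv_into U c)"
    by (rule smooth_on_cong[OF chart_facts(2)[OF A Uc] _
          smooth_on_frechet_derivative[OF smooth_funs_chart[OF f Uc], of w]])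
      (use f chart_inverse(3)[OF A Uc] in \<open>auto simp: coord_vector_def\<close>)
  from smooth_funs_cutoff_mult[OF A Uc \<rho> K this]
  show "(\<lambda>q. \<rho> q * coord_vector A (U, c) q w f) \<in> smooth_funs A" .
qed

lemma field_extension:
  assumes A: "smooth_atlas A" and v: "v \<in> tangent_space A p"
  obtains X where "X \<in> vector_fields A" "X p = v"
proof -
  obtain U c w where Uc: "(U, c) \<in> A" "p \<in> U" and w: "v = coord_vector A (U, c) p w"
    using v by (auto simp: tangent_space_def)
  obtain \<rho> K W where \<rho>: "\<rho> \<in> smooth_funs A" "closed K" "K \<subseteq> U" "\<And>q. q \<notin> K \<Longrightarrow> \<rho> q = 0"
    "open W" "p \<in> W" "\<And>q. q \<in> W \<Longrightarrow> \<rho> q = 1"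
    by (rule smooth_bump[OF A chart_facts(1)[OF A Uc(1)] Uc(2)]) blast
  show thesis
    by (rule that[OF chart_field[OF A Uc(1) \<rho>(1-4)]]) (simp_all add: w \<rho>(6,7))
qed

text \<open>
Global fields \<open>E i\<close> and functions \<open>y i\<close> that near \<open>q\<close> behave like the coordinate fields and the coordinates
of a chart, together with a cutoff function \<open>\<psi>\<close> at \<open>q\<close>. The expansion of vectors is multiplied by \<open>\<psi>\<close> to make
it valid at all points: an identity between global fields is needed before a connection, given only as
an operator on global fields, can be applied to it.
\<close>

definition local_frame ::
  "('b::topological_space, 'f::euclidean_space) chart set \<Rightarrow> 'b \<Rightarrow> ('f \<Rightarrow> 'b \<Rightarrow> 'b tangent) \<Rightarrow>
   ('f \<Rightarrow> 'b \<Rightarrow> real) \<Rightarrow> ('b \<Rightarrow> real) \<Rightarrow> bool" where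
  "local_frame B q E y \<psi> \<longleftrightarrow>
     (\<forall>i\<in>Basis. E i \<in> vector_fields B \<and> y i \<in> smooth_funs B) \<and> \<psi> \<in> smooth_funs B \<and>
     (\<exists>W. open W \<and> q \<in> W \<and>
       (\<forall>r\<in>W. \<psi> r = 1 \<and> (\<forall>i\<in>Basis. \<forall>j\<in>Basis. E i r (y j) = (if i = j then 1 else 0)))) \<and>
     (\<forall>r. \<forall>v\<in>tangent_space B r. \<forall>f. \<psi> r * v f = (\<Sum>i\<in>Basis. \<psi> r * v (y i) * E i r f))"

lemma local_frame_exists:
  fixes B :: "('b::{t2_space,second_countable_topology}, 'f::euclidean_space) chart set"
  assumes B: "smooth_atlas B"
  obtains E y \<psi> where "local_frame B q E y \<psi>"
proof -
  obtain V d where Vd: "(V, d) \<in> B" "q \<in> V" by (rule atlas_chart_exists[OF B])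
  obtain \<rho> K W where \<rho>: "\<rho> \<in> smooth_funs B" "closed K" "K \<subseteq> V" "\<And>q. q \<notin> K \<Longrightarrow> \<rho> q = 0"
    "open W" "q \<in> W" "\<And>q. q \<in> W \<Longrightarrow> \<rho> q = 1"
    by (rule smooth_bump[OF B chart_facts(1)[OF B Vd(1)] Vd(2)]) blast
  obtain \<psi> K' W' where \<psi>: "\<psi> \<in> smooth_funs B" "closed K'" "K' \<subseteq> W" "\<And>q. q \<notin> K' \<Longrightarrow> \<psi> q = 0"
    "open W'" "q \<in> W'" "\<And>q. q \<in> W' \<Longrightarrow> \<psi> q = 1"
    by (rule smooth_bump[OF B \<rho>(5,6)]) blast
  have WV: "W \<subseteq> V" using \<rho>(3,4,7) by (metis subsetD subsetI zero_neq_one)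
  have W'W: "W' \<subseteq> W" using \<psi>(3,4,7) by (metis subsetD subsetI zero_neq_one)
  define E where "E = (\<lambda>i r f. \<rho> r * coord_vector B (V, d) r i f)"
  define y where "y = (\<lambda>i r. \<rho> r * (d r \<bullet> i))"
  have opV: "open (d ` V)" by (rule chart_facts(2)[OF B Vd(1)])
  have E: "E i \<in> vector_fields B" for i
    unfolding E_def by (rule chart_field[OF B Vd(1) \<rho>(1-4)])
  have y: "y i \<in> smooth_funs B" for i
    unfolding y_def
  proof (rule smooth_funs_cutoff_mult[OF B Vd(1) \<rho>(1-4)])
    show "smooth_on (d ` V) ((\<lambda>r. d r \<bullet> i) \<circ> inv_into V d)"
      by (rule smooth_on_cong[OF opV _ smooth_on_linear[OF bounded_linear_inner_left opV]])
        (use chart_inverse(3)[OF B Vd(1)] in auto)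
  qed
  have coord_y: "coord_vector B (V, d) r w (y i) = w \<bullet> i" if "r \<in> W" for r w i
  proof (rule coord_vector_eqI[OF y])
    have op: "open (d ` W)" by (rule chart_open_image[OF B Vd(1) \<rho>(5) WV])
    show "(y i \<circ> inv_into V d has_derivative (\<lambda>w. w \<bullet> i)) (at (d r))"
      by (rule has_derivative_transform_within_open[OF
            bounded_linear_imp_has_derivative[OF bounded_linear_inner_left] op])
        (use that WV chart_inverse(1)[OF B Vd(1)] \<rho>(7) in \<open>auto simp: y_def subset_iff\<close>)
  qed
  have expand: "v f = (\<Sum>i\<in>Basis. v (y i) * E i r f)" if r: "r \<in> W" and v: "v \<in> tangent_space B r" for r v f
  proof -
    have rV: "r \<in> V" using r WV by blast
    obtain w where w: "v = coord_vector B (V, d) r w"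
      using v unfolding tangent_space_chart[OF B Vd(1) rV] by blast
    show ?thesis
    proof (cases "f \<in> smooth_funs B")
      case True
      let ?f' = "frechet_derivative (f \<circ> inv_into V d) (at (d r))"
      have lin: "linear ?f'"
        by (rule has_derivative_linear[OF smooth_funs_chart_derivative[OF B Vd(1) rV True]])
      have "?f' w = ?f' (\<Sum>i\<in>Basis. (w \<bullet> i) *\<^sub>R i)"
        by (simp only: euclidean_representation)
      also have "\<dots> = (\<Sum>i\<in>Basis. (w \<bullet> i) *\<^sub>R ?f' i)"
        by (simp only: linear_sum[OF lin] linear_scale[OF lin])
      finally show ?thesis
        unfolding w coord_y[OF r] by (simp add: E_def \<rho>(7)[OF r] coord_vector_def True)
    qed (simp add: w E_def coord_vector_def)
  qed
  have "local_frame B q E y \<psi>"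
    unfolding local_frame_def
  proof (intro conjI ballI allI exI[of _ W'])
    fix r v f assume v: "v \<in> tangent_space B r"
    show "\<psi> r * v f = (\<Sum>i\<in>Basis. \<psi> r * v (y i) * E i r f)"
    proof (cases "r \<in> W")
      case True
      show ?thesis by (subst expand[OF True v]) (simp add: sum_distrib_left mult.assoc)
    next
      case False
      then have "\<psi> r = 0" using \<psi>(3,4) by blast
      then show ?thesis by simp
    qed
  next
    fix r i j :: 'f and s assume "s \<in> W'" "i \<in> Basis" "j \<in> Basis"
    then show "E i s (y j) = (if i = j then 1 else 0)"
      using W'W by (auto simp: E_def coord_y \<rho>(7) inner_Basis)
  qed (use E y \<psi> in auto)
  then show thesis by (rule that)
qed

section \<open>Product manifolds\<close>

lemma prod_chart_inverse:
  assumes A: "smooth_atlas A" and B: "smooth_atlas B" and "(U, c) \<in> A" "(V, d) \<in> B" "x \<in> c ` U" "y \<in> d ` V"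
  shows "inv_into (U \<times> V) (map_prod c d) (x, y) = (inv_into U c x, inv_into V d y)"
proof (rule inv_into_f_eq)
  have "inj_on c U" "inj_on d V"
    using chart_inverse(1)[OF A assms(3)] chart_inverse(1)[OF B assms(4)] by (metis inj_onI)+
  then show "inj_on (map_prod c d) (U \<times> V)" by (rule map_prod_inj_on)
  show "(inv_into U c x, inv_into V d y) \<in> U \<times> V"
    using chart_inverse(2)[OF A assms(3,5)] chart_inverse(2)[OF B assms(4,6)] by simp
  show "map_prod c d (inv_into U c x, inv_into V d y) = (x, y)"
    using chart_inverse(3)[OF A assms(3,5)] chart_inverse(3)[OF B assms(4,6)] by simp
qed

lemma map_prod_image_Times: "map_prod c d ` (U \<times> V) = (c ` U) \<times> (d ` V)"
  by force

lemma prod_chart_homeomorphism: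
  assumes A: "smooth_atlas A" and B: "smooth_atlas B" and Uc: "(U, c) \<in> A" and Vd: "(V, d) \<in> B"
  shows "homeomorphism (U \<times> V) (map_prod c d ` (U \<times> V)) (map_prod c d) (inv_into (U \<times> V) (map_prod c d))"
proof -
  note inv = prod_chart_inverse[OF A B Uc Vd]
  have cont: "continuous_on U c" "continuous_on (c ` U) (inv_into U c)"
      "continuous_on V d" "continuous_on (d ` V) (inv_into V d)"
    using chart_facts(3)[OF A Uc] chart_facts(3)[OF B Vd] by (auto simp: homeomorphism_def)
  have 1: "continuous_on (U \<times> V) (\<lambda>z. (c (fst z), d (snd z)))"
    by (intro continuous_on_Pair continuous_on_compose2[OF cont(1)] continuous_on_compose2[OF cont(3)]
        continuous_on_fst continuous_on_snd continuous_on_id) auto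
  have 2: "continuous_on (c ` U \<times> d ` V) (\<lambda>z. (inv_into U c (fst z), inv_into V d (snd z)))"
    by (intro continuous_on_Pair continuous_on_compose2[OF cont(2)] continuous_on_compose2[OF cont(4)]
        continuous_on_fst continuous_on_snd continuous_on_id) auto
  have eq1: "map_prod c d z = (c (fst z), d (snd z))" for z by (cases z) simp
  have eq2: "inv_into (U \<times> V) (map_prod c d) z = (inv_into U c (fst z), inv_into V d (snd z))"
    if "z \<in> c ` U \<times> d ` V" for z
    using that inv[of "fst z" "snd z"] by (cases z) auto
  have "continuous_on (c ` U \<times> d ` V) (inv_into (U \<times> V) (map_prod c d))"
    using 2 eq2 by (simp cong: continuous_on_cong)
  moreover have "continuous_on (U \<times> V) (map_prod c d)" using 1 eq1 by (simp cong: continuous_on_cong)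
  moreover have "inv_into (U \<times> V) (map_prod c d) ` (c ` U \<times> d ` V) = U \<times> V"
  proof (intro equalityI subsetI)
    fix z assume "z \<in> U \<times> V"
    then have "z = inv_into (U \<times> V) (map_prod c d) (map_prod c d z)" "map_prod c d z \<in> c ` U \<times> d ` V"
      using inv chart_inverse(1)[OF A Uc] chart_inverse(1)[OF B Vd] by auto
    then show "z \<in> inv_into (U \<times> V) (map_prod c d) ` (c ` U \<times> d ` V)" by (rule image_eqI)
  qed (use eq2 chart_inverse(2)[OF A Uc] chart_inverse(2)[OF B Vd] in auto)
  ultimately show ?thesis
    unfolding homeomorphism_def map_prod_image_Times
    using inv chart_inverse[OF A Uc] chart_inverse[OF B Vd] by auto
qed

lemma prod_atlasE:
  assumes "(O', m) \<in> prod_atlas A B"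
  obtains U c V d where "(U, c) \<in> A" "(V, d) \<in> B" "O' = U \<times> V" "m = map_prod c d"
  using assms by (auto simp: prod_atlas_def)

lemma prod_atlasI: "(U, c) \<in> A \<Longrightarrow> (V, d) \<in> B \<Longrightarrow> (U \<times> V, map_prod c d) \<in> prod_atlas A B"
  by (auto simp: prod_atlas_def)

lemma smooth_on_fst_compose:
  assumes "open S" "open T" "smooth_on S f"
  shows "smooth_on (S \<times> T) (\<lambda>z. f (fst z))"
  by (rule smooth_on_compose[OF _ assms(1) _ smooth_on_linear[OF bounded_linear_fst] assms(3)])
    (use assms(1,2) in \<open>auto intro: open_Times\<close>)

lemma smooth_on_snd_compose:
  assumes "open S" "open T" "smooth_on T f"
  shows "smooth_on (S \<times> T) (\<lambda>z. f (snd z))"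
  by (rule smooth_on_compose[OF _ assms(2) _ smooth_on_linear[OF bounded_linear_snd] assms(3)])
    (use assms(1,2) in \<open>auto intro: open_Times\<close>)

lemma smooth_atlas_prod:
  fixes A :: "('a::{t2_space,second_countable_topology}, 'e::euclidean_space) chart set"
    and B :: "('b::{t2_space,second_countable_topology}, 'f::euclidean_space) chart set"
  assumes A: "smooth_atlas A" and B: "smooth_atlas B"
  shows "smooth_atlas (prod_atlas A B)"
proof -
  have cover: "(\<Union>(W, m)\<in>prod_atlas A B. W) = UNIV"
  proof (intro equalityI subsetI)
    fix z :: "'a \<times> 'b"
    obtain U c where "(U, c) \<in> A" "fst z \<in> U" by (rule atlas_chart_exists[OF A])
    moreover obtain V d where "(V, d) \<in> B" "snd z \<in> V" by (rule atlas_chart_exists[OF B])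
    ultimately have "z \<in> U \<times> V" "(U \<times> V, map_prod c d) \<in> prod_atlas A B"
      by (auto simp: mem_Times_iff intro: prod_atlasI)
    then show "z \<in> (\<Union>(W, m)\<in>prod_atlas A B. W)" by blast
  qed simp
  have charts: "open W \<and> open (m ` W) \<and> homeomorphism W (m ` W) m (inv_into W m)"
    if Wm: "(W, m) \<in> prod_atlas A B" for W m
  proof -
    obtain U c V d where W: "(U, c) \<in> A" "(V, d) \<in> B" "W = U \<times> V" "m = map_prod c d"
      using Wm by (rule prod_atlasE)
    show ?thesis
      unfolding W(3,4) using prod_chart_homeomorphism[OF A B W(1,2)]
        chart_facts(1,2)[OF A W(1)] chart_facts(1,2)[OF B W(2)]
      by (simp add: map_prod_image_Times open_Times)
  qed
  have trans: "smooth_on (m ` (W \<inter> W')) (m' \<circ> inv_into W m)"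
    if Wm: "(W, m) \<in> prod_atlas A B" and Wm': "(W', m') \<in> prod_atlas A B" for W m W' m'
  proof -
    obtain U c V d where W: "(U, c) \<in> A" "(V, d) \<in> B" "W = U \<times> V" "m = map_prod c d"
      using Wm by (rule prod_atlasE)
    obtain U' c' V' d' where W': "(U', c') \<in> A" "(V', d') \<in> B" "W' = U' \<times> V'" "m' = map_prod c' d'"
      using Wm' by (rule prod_atlasE)
    have dom: "m ` (W \<inter> W') = c ` (U \<inter> U') \<times> d ` (V \<inter> V')"
      unfolding W W' Times_Int_Times map_prod_image_Times ..
    have op: "open (c ` (U \<inter> U'))" "open (d ` (V \<inter> V'))"
      using chart_open_image[OF A W(1)] chart_open_image[OF B W(2)] chart_facts(1)[OF A] chart_facts(1)[OF B] W W'
      by (metis inf_le1 open_Int)+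
    have opT: "open (c ` (U \<inter> U') \<times> d ` (V \<inter> V'))" using op by (rule open_Times)
    have "smooth_on (c ` (U \<inter> U') \<times> d ` (V \<inter> V'))
        (\<lambda>z. ((c' \<circ> inv_into U c) (fst z), (d' \<circ> inv_into V d) (snd z)))"
      using transition_smooth[OF A W(1) W'(1)] transition_smooth[OF B W(2) W'(2)]
      by (intro smooth_on_Pair smooth_on_fst_compose smooth_on_snd_compose op opT)
    then show ?thesis
      unfolding dom
      by (rule smooth_on_cong[OF opT, rotated])
        (use prod_chart_inverse[OF A B W(1,2)] in \<open>auto simp: W W'\<close>)
  qed
  show ?thesis
    unfolding smooth_atlas_def using cover charts trans by auto
qed

lemma smooth_map_fst:
  assumes A: "smooth_atlas A" and B: "smooth_atlas B"
  shows "smooth_map (prod_atlas A B) A fst"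
proof -
  have "smooth_on (m ` (W \<inter> fst -` U')) (c' \<circ> fst \<circ> inv_into W m)"
    if Wm: "(W, m) \<in> prod_atlas A B" and Uc': "(U', c') \<in> A" for W m U' c'
  proof -
    obtain U c V d where W: "(U, c) \<in> A" "(V, d) \<in> B" "W = U \<times> V" "m = map_prod c d"
      using Wm by (rule prod_atlasE)
    have dom: "m ` (W \<inter> fst -` U') = c ` (U \<inter> U') \<times> d ` V"
      unfolding W map_prod_image_Times[symmetric] by (rule arg_cong[of _ _ "\<lambda>S. map_prod c d ` S"]) auto
    have op: "open (c ` (U \<inter> U'))" "open (d ` V)"
      using chart_open_image[OF A W(1)] chart_facts(2)[OF B W(2)] chart_facts(1)[OF A] W Uc'
      by (metis inf_le1 open_Int)+
    have opT: "open (c ` (U \<inter> U') \<times> d ` V)" using op by (rule open_Times)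
    show ?thesis
      unfolding dom
      by (rule smooth_on_cong[OF opT _ smooth_on_fst_compose[OF op transition_smooth[OF A W(1) Uc']]])
        (use prod_chart_inverse[OF A B W(1,2)] in \<open>auto simp: W\<close>)
  qed
  then show ?thesis unfolding smooth_map_def by (auto intro: continuous_on_fst continuous_on_id)
qed

lemma smooth_map_snd:
  assumes A: "smooth_atlas A" and B: "smooth_atlas B"
  shows "smooth_map (prod_atlas A B) B snd"
proof -
  have "smooth_on (m ` (W \<inter> snd -` V')) (d' \<circ> snd \<circ> inv_into W m)"
    if Wm: "(W, m) \<in> prod_atlas A B" and Vd': "(V', d') \<in> B" for W m V' d'
  proof -
    obtain U c V d where W: "(U, c) \<in> A" "(V, d) \<in> B" "W = U \<times> V" "m = map_prod c d"
      using Wm by (rule prod_atlasE)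
    have dom: "m ` (W \<inter> snd -` V') = c ` U \<times> d ` (V \<inter> V')"
      unfolding W map_prod_image_Times[symmetric] by (rule arg_cong[of _ _ "\<lambda>S. map_prod c d ` S"]) auto
    have op: "open (c ` U)" "open (d ` (V \<inter> V'))"
      using chart_open_image[OF B W(2)] chart_facts(2)[OF A W(1)] chart_facts(1)[OF B] W Vd'
      by (metis inf_le1 open_Int)+
    have opT: "open (c ` U \<times> d ` (V \<inter> V'))" using op by (rule open_Times)
    show ?thesis
      unfolding dom
      by (rule smooth_on_cong[OF opT _ smooth_on_snd_compose[OF op transition_smooth[OF B W(2) Vd']]])
        (use prod_chart_inverse[OF A B W(1,2)] in \<open>auto simp: W\<close>)
  qed
  then show ?thesis unfolding smooth_map_def by (auto intro: continuous_on_snd continuous_on_id)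
qed

lemma differential_fst_coord:
  assumes A: "smooth_atlas (A :: ('a::{t2_space,second_countable_topology}, 'e::euclidean_space) chart set)"
    and B: "smooth_atlas (B :: ('b::{t2_space,second_countable_topology}, 'f::euclidean_space) chart set)"
    and Uc: "(U, c) \<in> A" and Vd: "(V, d) \<in> B" and p: "p \<in> U \<times> V"
  shows "differential A fst (coord_vector (prod_atlas A B) (U \<times> V, map_prod c d) p w) =
    coord_vector A (U, c) (fst p) (fst w)"
proof -
  have op: "open (c ` U \<times> d ` V)" using chart_facts(2)[OF A Uc] chart_facts(2)[OF B Vd] by (rule open_Times)
  have "(c \<circ> fst \<circ> inv_into (U \<times> V) (map_prod c d) has_derivative fst) (at (map_prod c d p))"
    by (rule has_derivative_transform_within_open[OF bounded_linear_imp_has_derivative[OF bounded_linear_fst] op])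
      (use p prod_chart_inverse[OF A B Uc Vd] chart_inverse[OF A Uc] in auto)
  from frechet_derivative_at[OF this] show ?thesis
    using differential_coord_vector[OF smooth_atlas_prod[OF A B] A smooth_map_fst[OF A B]
        prod_atlasI[OF Uc Vd] p Uc, of w] p by (auto simp: mem_Times_iff)
qed

lemma differential_snd_coord:
  assumes A: "smooth_atlas (A :: ('a::{t2_space,second_countable_topology}, 'e::euclidean_space) chart set)"
    and B: "smooth_atlas (B :: ('b::{t2_space,second_countable_topology}, 'f::euclidean_space) chart set)"
    and Uc: "(U, c) \<in> A" and Vd: "(V, d) \<in> B" and p: "p \<in> U \<times> V"
  shows "differential B snd (coord_vector (prod_atlas A B) (U \<times> V, map_prod c d) p w) =
    coord_vector B (V, d) (snd p) (snd w)"
proof -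
  have op: "open (c ` U \<times> d ` V)" using chart_facts(2)[OF A Uc] chart_facts(2)[OF B Vd] by (rule open_Times)
  have "(d \<circ> snd \<circ> inv_into (U \<times> V) (map_prod c d) has_derivative snd) (at (map_prod c d p))"
    by (rule has_derivative_transform_within_open[OF bounded_linear_imp_has_derivative[OF bounded_linear_snd] op])
      (use p prod_chart_inverse[OF A B Uc Vd] chart_inverse[OF B Vd] in auto)
  from frechet_derivative_at[OF this] show ?thesis
    using differential_coord_vector[OF smooth_atlas_prod[OF A B] B smooth_map_snd[OF A B]
        prod_atlasI[OF Uc Vd] p Vd, of w] p by (auto simp: mem_Times_iff)
qed

text \<open>
In a product chart the coordinate fields of \<open>(w1, 0)\<close> and \<open>(0, w2)\<close> are tangent to the factors, and
multiplication by a cutoff function preserves this.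
\<close>

lemma factor_fields_exist:
  assumes A: "smooth_atlas (A :: ('a::{t2_space,second_countable_topology}, 'e::euclidean_space) chart set)"
    and B: "smooth_atlas (B :: ('b::{t2_space,second_countable_topology}, 'f::euclidean_space) chart set)"
    and Uc: "(U, c) \<in> A" and Vd: "(V, d) \<in> B" and p: "p \<in> U \<times> V"
  obtains X Z where "X \<in> first_factor_fields A B" "Z \<in> second_factor_fields A B"
    "X p = coord_vector (prod_atlas A B) (U \<times> V, map_prod c d) p (w1, 0)"
    "Z p = coord_vector (prod_atlas A B) (U \<times> V, map_prod c d) p (0, w2)"
proof -
  let ?P = "prod_atlas A B" and ?k = "(U \<times> V, map_prod c d)"
  have P: "smooth_atlas ?P" by (rule smooth_atlas_prod[OF A B])
  have k: "?k \<in> ?P" by (rule prod_atlasI[OF Uc Vd])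
  obtain \<rho> K W where \<rho>: "\<rho> \<in> smooth_funs ?P" "closed K" "K \<subseteq> U \<times> V" "\<And>q. q \<notin> K \<Longrightarrow> \<rho> q = 0"
    "open W" "p \<in> W" "\<And>q. q \<in> W \<Longrightarrow> \<rho> q = 1"
    by (rule smooth_bump[OF P chart_facts(1)[OF P k] p]) blast
  define Y where "Y = (\<lambda>w q f. \<rho> q * coord_vector ?P ?k q w f)"
  have Y: "Y w \<in> vector_fields ?P" for w
    unfolding Y_def by (rule chart_field[OF P k \<rho>(1-4)])
  have Yp: "Y w p = coord_vector ?P ?k p w" for w
    by (simp add: Y_def \<rho>(6,7))
  have "differential B snd (Y (w1, 0) q) = zero_vector" for q
  proof (cases "q \<in> U \<times> V")
    case True
    then show ?thesis
      using differential_snd_coord[OF A B Uc Vd True, of "(w1, 0)"] coord_vector_zero[OF B Vd, of "snd q"]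
      by (simp add: Y_def differential_scale zero_vector_def mem_Times_iff)
  next
    case False
    then have "\<rho> q = 0" using \<rho>(3,4) by blast
    then show ?thesis by (simp add: Y_def differential_def zero_vector_def)
  qed
  moreover have "differential A fst (Y (0, w2) q) = zero_vector" for q
  proof (cases "q \<in> U \<times> V")
    case True
    then show ?thesis
      using differential_fst_coord[OF A B Uc Vd True, of "(0, w2)"] coord_vector_zero[OF A Uc, of "fst q"]
      by (simp add: Y_def differential_scale zero_vector_def mem_Times_iff)
  next
    case False
    then have "\<rho> q = 0" using \<rho>(3,4) by blast
    then show ?thesis by (simp add: Y_def differential_def zero_vector_def)
  qed
  ultimately show thesis
    using that[of "Y (w1, 0)" "Y (0, w2)"] Y Yp
    by (simp add: first_factor_fields_def second_factor_fields_def)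
qed

lemma tangent_split:
  assumes A: "smooth_atlas (A :: ('a::{t2_space,second_countable_topology}, 'e::euclidean_space) chart set)"
    and B: "smooth_atlas (B :: ('b::{t2_space,second_countable_topology}, 'f::euclidean_space) chart set)"
    and u: "u \<in> tangent_space (prod_atlas A B) p"
  obtains X Z where "X \<in> first_factor_fields A B" "Z \<in> second_factor_fields A B"
    "u = lincomb 1 (X p) 1 (Z p)"
proof -
  let ?P = "prod_atlas A B"
  have P: "smooth_atlas ?P" by (rule smooth_atlas_prod[OF A B])
  obtain U c where Uc: "(U, c) \<in> A" "fst p \<in> U" by (rule atlas_chart_exists[OF A])
  obtain V d where Vd: "(V, d) \<in> B" "snd p \<in> V" by (rule atlas_chart_exists[OF B])
  have p: "p \<in> U \<times> V" using Uc Vd by (simp add: mem_Times_iff)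
  obtain w where w: "u = coord_vector ?P (U \<times> V, map_prod c d) p w"
    using u unfolding tangent_space_chart[OF P prod_atlasI[OF Uc(1) Vd(1)] p] by blast
  obtain X Z where XZ: "X \<in> first_factor_fields A B" "Z \<in> second_factor_fields A B"
    "X p = coord_vector ?P (U \<times> V, map_prod c d) p (fst w, 0)"
    "Z p = coord_vector ?P (U \<times> V, map_prod c d) p (0, snd w)"
    by (rule factor_fields_exist[OF A B Uc(1) Vd(1) p])
  show thesis
    by (rule that[OF XZ(1,2)])
      (simp add: XZ(3,4) w coord_vector_lincomb[OF P prod_atlasI[OF Uc(1) Vd(1)] p])
qed

text \<open>
A frame field \<open>E i\<close> of \<open>B\<close> is not zero because it takes the value 1 on its own coordinate \<open>y i\<close>.
\<close>

lemma second_factor_field_nonzero: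
  assumes A: "smooth_atlas (A :: ('a::{t2_space,second_countable_topology}, 'e::euclidean_space) chart set)"
    and B: "smooth_atlas (B :: ('b::{t2_space,second_countable_topology}, 'f::euclidean_space) chart set)"
  obtains Z where "Z \<in> second_factor_fields A B" "Z p \<noteq> zero_vector"
proof -
  obtain U c where Uc: "(U, c) \<in> A" "fst p \<in> U" by (rule atlas_chart_exists[OF A])
  obtain V d where Vd: "(V, d) \<in> B" "snd p \<in> V" by (rule atlas_chart_exists[OF B])
  have p: "p \<in> U \<times> V" using Uc Vd by (simp add: mem_Times_iff)
  obtain E y \<psi> where fr: "local_frame B (snd p) E y \<psi>" by (rule local_frame_exists[OF B])
  obtain i :: 'f where i: "i \<in> Basis" using nonempty_Basis by blast
  have E: "E i \<in> vector_fields B" using fr i by (simp add: local_frame_def)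
  have E1: "E i (snd p) (y i) = 1" using fr i unfolding local_frame_def by auto
  obtain w where w: "E i (snd p) = coord_vector B (V, d) (snd p) w"
    using field_tangent[OF E, of "snd p"] unfolding tangent_space_chart[OF B Vd] by blast
  obtain X Z where XZ: "X \<in> first_factor_fields A B" "Z \<in> second_factor_fields A B"
    "X p = coord_vector (prod_atlas A B) (U \<times> V, map_prod c d) p (0, 0)"
    "Z p = coord_vector (prod_atlas A B) (U \<times> V, map_prod c d) p (0, w)"
    by (rule factor_fields_exist[OF A B Uc(1) Vd(1) p])
  have "differential B snd (Z p) (y i) = 1"
    using differential_snd_coord[OF A B Uc(1) Vd(1) p, of "(0, w)"] XZ(4) w E1 by simp
  then have "Z p \<noteq> zero_vector" by (auto simp: differential_def zero_vector_def split: if_splits)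
  then show thesis using XZ(2) that by blast
qed

section \<open>Metrics and connections along a map\<close>

lemma local_frame_facts:
  assumes "local_frame B q E y \<psi>"
  shows "i \<in> Basis \<Longrightarrow> E i \<in> vector_fields B" "i \<in> Basis \<Longrightarrow> y i \<in> smooth_funs B" "\<psi> \<in> smooth_funs B"
    "v \<in> tangent_space B r \<Longrightarrow> \<psi> r * v f = (\<Sum>i\<in>Basis. \<psi> r * v (y i) * E i r f)"
  using assms unfolding local_frame_def by blast+

lemma local_frame_neighbourhood:
  assumes "local_frame B (F p) E y \<psi>" "continuous_on UNIV F"
  obtains W where "open W" "p \<in> W" "\<And>q. q \<in> W \<Longrightarrow> \<psi> (F q) = 1"
proof -
  obtain W where "open W" "F p \<in> W" "\<forall>r\<in>W. \<psi> r = 1"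
    using assms(1) unfolding local_frame_def by blast
  then show thesis using that[of "F -` W"] assms(2) by (simp add: open_vimage)
qed

lemma local_frame_expand:
  assumes "local_frame B q E y \<psi>" "\<psi> r = 1" "v \<in> tangent_space B r"
  shows "v f = (\<Sum>i\<in>Basis. v (y i) * E i r f)"
  using local_frame_facts(4)[OF assms(1,3), of f] assms(2) by simp

lemma metric_facts:
  assumes "riemannian_metric A g" "u \<in> tangent_space A p" "v \<in> tangent_space A p" "w \<in> tangent_space A p"
  shows "g p (lincomb a u b v) w = a * g p u w + b * g p v w" "g p u v = g p v u"
    "smooth_atlas A \<Longrightarrow> g p w (lincomb a u b v) = a * g p w u + b * g p w v"
proof -
  show 1: "g p (lincomb a u b v) w = a * g p u w + b * g p v w" and "g p u v = g p v u"
    using assms unfolding riemannian_metric_def by blast+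
  show "g p w (lincomb a u b v) = a * g p w u + b * g p w v" if "smooth_atlas A"
  proof -
    have "g p w (lincomb a u b v) = g p (lincomb a u b v) w" "g p w u = g p u w" "g p w v = g p v w"
      using assms tangent_lincomb[OF that assms(2,3)] unfolding riemannian_metric_def by blast+
    then show ?thesis using 1 by simp
  qed
qed

lemma metric_smooth:
  "riemannian_metric A g \<Longrightarrow> X \<in> vector_fields A \<Longrightarrow> Y \<in> vector_fields A \<Longrightarrow> (\<lambda>p. g p (X p) (Y p)) \<in> smooth_funs A"
  unfolding riemannian_metric_def by blast

lemma metric_zero:
  assumes "smooth_atlas A" "riemannian_metric A g" "w \<in> tangent_space A p"
  shows "g p zero_vector w = 0" "g p w zero_vector = 0"
  using metric_facts(1,3)[OF assms(2) assms(3) assms(3) assms(3), of 0 0] assms(1)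
  by (simp_all add: lincomb_def zero_vector_def)

lemma metric_definite:
  assumes "riemannian_metric A g" "u \<in> tangent_space A p" "g p u u = 0"
  shows "u = zero_vector"
proof (rule ccontr)
  assume "u \<noteq> zero_vector"
  then have "g p u u > 0" using assms(1,2) unfolding riemannian_metric_def by blast
  then show False using assms(3) by simp
qed

lemma metric_sum:
  assumes A: "smooth_atlas A" and g: "riemannian_metric A g" and w: "w \<in> tangent_space A p"
    and "finite I" "\<And>i. i \<in> I \<Longrightarrow> e i \<in> tangent_space A p"
  shows "g p (\<lambda>f. \<Sum>i\<in>I. a i * e i f) w = (\<Sum>i\<in>I. a i * g p (e i) w)"
  using assms(4,5)
proof (induction I rule: finite_induct)
  case empty
  then show ?case using metric_zero(1)[OF A g w] by (simp add: zero_vector_def)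
next
  case (insert i I)
  have "(\<lambda>f. \<Sum>i\<in>insert i I. a i * e i f) = lincomb (a i) (e i) 1 (\<lambda>f. \<Sum>i\<in>I. a i * e i f)"
    using insert by (simp add: lincomb_def)
  moreover have "(\<lambda>f. \<Sum>i\<in>I. a i * e i f) \<in> tangent_space A p"
    using insert by (intro tangent_sum[OF A]) auto
  ultimately show ?case
    using metric_facts(1)[OF g _ _ w, of "e i" "\<lambda>f. \<Sum>i\<in>I. a i * e i f" "a i" 1] insert by simp
qed

lemma metric_sum_right:
  assumes A: "smooth_atlas A" and g: "riemannian_metric A g" and w: "w \<in> tangent_space A p"
    and I: "finite I" "\<And>i. i \<in> I \<Longrightarrow> e i \<in> tangent_space A p"
  shows "g p w (\<lambda>f. \<Sum>i\<in>I. a i * e i f) = (\<Sum>i\<in>I. a i * g p w (e i))"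
proof -
  have "g p w (\<lambda>f. \<Sum>i\<in>I. a i * e i f) = g p (\<lambda>f. \<Sum>i\<in>I. a i * e i f) w"
    by (rule metric_facts(2)[OF g w tangent_sum[OF A I] w])
  also have "\<dots> = (\<Sum>i\<in>I. a i * g p (e i) w)"
    by (rule metric_sum[OF A g w I])
  also have "\<dots> = (\<Sum>i\<in>I. a i * g p w (e i))"
    by (intro sum.cong refl) (simp add: metric_facts(2)[OF g w I(2) w])
  finally show ?thesis .
qed

lemma metric_frame:
  assumes B: "smooth_atlas B" and g: "riemannian_metric B g" and fr: "local_frame B q E y \<psi>"
    and r: "\<psi> r = 1" and u: "u \<in> tangent_space B r" and v: "v \<in> tangent_space B r"
  shows "g r u v = (\<Sum>i\<in>Basis. u (y i) * g r (E i r) v)"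
    and "g r u v = (\<Sum>i\<in>Basis. v (y i) * g r u (E i r))"
proof -
  have E: "\<And>i. i \<in> Basis \<Longrightarrow> E i r \<in> tangent_space B r"
    using field_tangent[OF local_frame_facts(1)[OF fr]] .
  have u': "u = (\<lambda>f. \<Sum>i\<in>Basis. u (y i) * E i r f)" and v': "v = (\<lambda>f. \<Sum>i\<in>Basis. v (y i) * E i r f)"
    using local_frame_expand[OF fr r] u v by blast+
  have "g r u v = g r (\<lambda>f. \<Sum>i\<in>Basis. u (y i) * E i r f) v" by (rule arg_cong[OF u'])
  then show "g r u v = (\<Sum>i\<in>Basis. u (y i) * g r (E i r) v)"
    using metric_sum[OF B g v finite_Basis E] by simp
  have "g r u v = g r u (\<lambda>f. \<Sum>i\<in>Basis. v (y i) * E i r f)" by (rule arg_cong[OF v'])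
  then show "g r u v = (\<Sum>i\<in>Basis. v (y i) * g r u (E i r))"
    using metric_sum_right[OF B g u finite_Basis E] by simp
qed

context
  fixes A :: "('a::{t2_space,second_countable_topology}, 'e::euclidean_space) chart set"
    and B :: "('b::{t2_space,second_countable_topology}, 'f::euclidean_space) chart set"
    and F :: "'a \<Rightarrow> 'b"
  assumes A: "smooth_atlas A" and B: "smooth_atlas B" and F: "smooth_map A B F"
begin

text \<open>
Near any point the product is a sum of products of components of \<open>V\<close>, components of \<open>V'\<close> and pulled-back
components of the metric.
\<close>

lemma metric_along_smooth:
  assumes g: "riemannian_metric B g" and V: "V \<in> fields_along A B F" and V': "V' \<in> fields_along A B F"
  shows "(\<lambda>q. g (F q) (V q) (V' q)) \<in> smooth_funs A"
proof (rule smooth_funs_local_eqI[OF A])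
  fix p
  obtain E y \<psi> where fr: "local_frame B (F p) E y \<psi>" by (rule local_frame_exists[OF B])
  obtain W where W: "open W" "p \<in> W" "\<And>q. q \<in> W \<Longrightarrow> \<psi> (F q) = 1"
    by (rule local_frame_neighbourhood[OF fr smooth_map_continuous[OF F]]) blast
  note E = local_frame_facts(1)[OF fr] and y = local_frame_facts(2)[OF fr]
  let ?h = "\<lambda>q. \<Sum>i\<in>Basis. V q (y i) * (\<Sum>j\<in>Basis. V' q (y j) * g (F q) (E i (F q)) (E j (F q)))"
  have "?h \<in> smooth_funs A"
    by (intro smooth_funs_sum smooth_funs_mult finite_Basis A field_smooth[OF V] field_smooth[OF V'] y
        smooth_funs_compose[OF A B F metric_smooth[OF g E E]])
  moreover have "g (F q) (V q) (V' q) = ?h q" if "q \<in> W" for q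
  proof -
    have "g (F q) (E i (F q)) (V' q) = (\<Sum>j\<in>Basis. V' q (y j) * g (F q) (E i (F q)) (E j (F q)))"
      if "i \<in> Basis" for i
      by (rule metric_frame(2)[OF B g fr W(3)[OF \<open>q \<in> W\<close>] field_tangent[OF E[OF that]] field_tangent[OF V']])
    then show ?thesis
      unfolding metric_frame(1)[OF B g fr W(3)[OF that] field_tangent[OF V] field_tangent[OF V']]
      by (intro sum.cong) auto
  qed
  ultimately show "\<exists>W f'. open W \<and> p \<in> W \<and> f' \<in> smooth_funs A \<and> (\<forall>q\<in>W. g (F q) (V q) (V' q) = f' q)"
    using W(1,2) by blast
qed

text \<open>
A vector \<open>t\<close> in the kernel of the differential of \<open>F\<close> does not see the components of the metric of \<open>B\<close>
in a local frame, so only the components of \<open>V\<close> and \<open>V'\<close> are differentiated. For a projection of a product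
this says that the metric of one factor is constant along the other.
\<close>

lemma metric_along_derivative:
  assumes g: "riemannian_metric B g" and V: "V \<in> fields_along A B F" and V': "V' \<in> fields_along A B F"
    and t: "t \<in> tangent_space A p" and t0: "\<And>f. f \<in> smooth_funs B \<Longrightarrow> t (\<lambda>q. f (F q)) = 0"
  shows "(\<lambda>f. t (\<lambda>q. V q f)) \<in> tangent_space B (F p)"
    and "t (\<lambda>q. g (F q) (V q) (V' q)) =
      g (F p) (\<lambda>f. t (\<lambda>q. V q f)) (V' p) + g (F p) (V p) (\<lambda>f. t (\<lambda>q. V' q f))"
proof -
  obtain E y \<psi> where fr: "local_frame B (F p) E y \<psi>" by (rule local_frame_exists[OF B])
  obtain W where W: "open W" "p \<in> W" "\<And>q. q \<in> W \<Longrightarrow> \<psi> (F q) = 1"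
    by (rule local_frame_neighbourhood[OF fr smooth_map_continuous[OF F]]) blast
  note E = local_frame_facts(1)[OF fr] and y = local_frame_facts(2)[OF fr]
  have deriv: "(\<lambda>f. t (\<lambda>q. U q f)) = (\<lambda>f. \<Sum>i\<in>Basis. t (\<lambda>q. U q (y i)) * E i (F p) f)"
    if U: "U \<in> fields_along A B F" for U
  proof
    fix f
    show "t (\<lambda>q. U q f) = (\<Sum>i\<in>Basis. t (\<lambda>q. U q (y i)) * E i (F p) f)"
    proof (cases "f \<in> smooth_funs B")
      case True
      have sE: "(\<lambda>q. E i (F q) f) \<in> smooth_funs A" if "i \<in> Basis" for i
        by (rule smooth_funs_compose[OF A B F field_smooth[OF E[OF that] True]])
      have sU: "(\<lambda>q. U q (y i) * E i (F q) f) \<in> smooth_funs A" if "i \<in> Basis" for i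
        by (rule smooth_funs_mult[OF A field_smooth[OF U y[OF that]] sE[OF that]])
      have "t (\<lambda>q. U q f) = t (\<lambda>q. \<Sum>i\<in>Basis. U q (y i) * E i (F q) f)"
        by (rule tangent_local[OF A t field_smooth[OF U True] smooth_funs_sum[OF A finite_Basis sU] W(1,2)])
          (auto intro: local_frame_expand[OF fr W(3) field_tangent[OF U]])
      also have "\<dots> = (\<Sum>i\<in>Basis. t (\<lambda>q. U q (y i) * E i (F q) f))"
        by (rule tangent_fun_sum[OF A t finite_Basis sU])
      also have "\<dots> = (\<Sum>i\<in>Basis. t (\<lambda>q. U q (y i)) * E i (F p) f)"
        using tangent_fun_mult[OF A t field_smooth[OF U y] sE] t0[OF field_smooth[OF E True]]
        by (intro sum.cong) auto
      finally show ?thesis .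
    next
      case False
      have "(\<lambda>q. U q f) = (\<lambda>q. 0)" using tangent_nonsmooth[OF field_tangent[OF U] False] by blast
      moreover have "E i (F p) f = 0" if "i \<in> Basis" for i
        using tangent_nonsmooth[OF field_tangent[OF E[OF that]] False] .
      ultimately show ?thesis
        using tangent_fun_const[OF A t] by simp
    qed
  qed
  have Ep: "\<And>i. i \<in> Basis \<Longrightarrow> E i (F p) \<in> tangent_space B (F p)"
    by (rule field_tangent[OF E])
  show "(\<lambda>f. t (\<lambda>q. V q f)) \<in> tangent_space B (F p)"
    unfolding deriv[OF V] by (rule tangent_sum[OF B finite_Basis Ep])
  let ?g = "\<lambda>i j q. g (F q) (E i (F q)) (E j (F q))"
  have sg: "?g i j \<in> smooth_funs A" if "i \<in> Basis" "j \<in> Basis" for i j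
    using smooth_funs_compose[OF A B F metric_smooth[OF g E[OF that(1)] E[OF that(2)]]] .
  have sV: "(\<lambda>q. V q (y i)) \<in> smooth_funs A" and sV': "(\<lambda>q. V' q (y i)) \<in> smooth_funs A" if "i \<in> Basis" for i
    using field_smooth[OF V y[OF that]] field_smooth[OF V' y[OF that]] .
  have sVg: "(\<lambda>q. V' q (y j) * ?g i j q) \<in> smooth_funs A" if "i \<in> Basis" "j \<in> Basis" for i j
    by (rule smooth_funs_mult[OF A sV'[OF that(2)] sg[OF that]])
  have sS: "(\<lambda>q. \<Sum>j\<in>Basis. V' q (y j) * ?g i j q) \<in> smooth_funs A" if "i \<in> Basis" for i
    by (rule smooth_funs_sum[OF A finite_Basis sVg[OF that]])
  have sVS: "(\<lambda>q. V q (y i) * (\<Sum>j\<in>Basis. V' q (y j) * ?g i j q)) \<in> smooth_funs A" if "i \<in> Basis" for i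
    by (rule smooth_funs_mult[OF A sV[OF that] sS[OF that]])
  have E2: "g (F q) (E i (F q)) (V' q) = (\<Sum>j\<in>Basis. V' q (y j) * ?g i j q)" if "q \<in> W" "i \<in> Basis" for q i
    by (rule metric_frame(2)[OF B g fr W(3)[OF that(1)] field_tangent[OF E[OF that(2)]] field_tangent[OF V']])
  have E1: "g (F q) (V q) (V' q) = (\<Sum>i\<in>Basis. V q (y i) * (\<Sum>j\<in>Basis. V' q (y j) * ?g i j q))"
    if "q \<in> W" for q
    unfolding metric_frame(1)[OF B g fr W(3)[OF that] field_tangent[OF V] field_tangent[OF V']]
    using E2[OF that] by (intro sum.cong) auto
  have tg: "t (?g i j) = 0" if "i \<in> Basis" "j \<in> Basis" for i j
    by (rule t0[OF metric_smooth[OF g E[OF that(1)] E[OF that(2)]]])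
  have tS: "t (\<lambda>q. \<Sum>j\<in>Basis. V' q (y j) * ?g i j q) = (\<Sum>j\<in>Basis. t (\<lambda>q. V' q (y j)) * ?g i j p)"
    if "i \<in> Basis" for i
  proof -
    have "t (\<lambda>q. \<Sum>j\<in>Basis. V' q (y j) * ?g i j q) = (\<Sum>j\<in>Basis. t (\<lambda>q. V' q (y j) * ?g i j q))"
      by (rule tangent_fun_sum[OF A t finite_Basis sVg[OF that]])
    also have "\<dots> = (\<Sum>j\<in>Basis. t (\<lambda>q. V' q (y j)) * ?g i j p)"
      using tangent_fun_mult[OF A t sV' sg[OF that]] tg[OF that] by (intro sum.cong) auto
    finally show ?thesis .
  qed
  have E3: "g (F p) (E i (F p)) (\<lambda>f. \<Sum>j\<in>Basis. t (\<lambda>q. V' q (y j)) * E j (F p) f) =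
      (\<Sum>j\<in>Basis. t (\<lambda>q. V' q (y j)) * ?g i j p)" if "i \<in> Basis" for i
    by (rule metric_sum_right[OF B g Ep[OF that] finite_Basis Ep])
  have "t (\<lambda>q. g (F q) (V q) (V' q)) = t (\<lambda>q. \<Sum>i\<in>Basis. V q (y i) * (\<Sum>j\<in>Basis. V' q (y j) * ?g i j q))"
    by (rule tangent_local[OF A t metric_along_smooth[OF g V V'] smooth_funs_sum[OF A finite_Basis sVS] W(1,2) E1])
  also have "\<dots> = (\<Sum>i\<in>Basis. t (\<lambda>q. V q (y i) * (\<Sum>j\<in>Basis. V' q (y j) * ?g i j q)))"
    by (rule tangent_fun_sum[OF A t finite_Basis sVS])
  also have "\<dots> = (\<Sum>i\<in>Basis. t (\<lambda>q. V q (y i)) * (\<Sum>j\<in>Basis. V' p (y j) * ?g i j p) +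
      V p (y i) * (\<Sum>j\<in>Basis. t (\<lambda>q. V' q (y j)) * ?g i j p))"
    using tangent_fun_mult[OF A t sV sS] tS by (intro sum.cong) auto
  also have "\<dots> = (\<Sum>i\<in>Basis. t (\<lambda>q. V q (y i)) * g (F p) (E i (F p)) (V' p)) +
      (\<Sum>i\<in>Basis. V p (y i) * g (F p) (E i (F p)) (\<lambda>f. t (\<lambda>q. V' q f)))"
    unfolding sum.distrib[symmetric] deriv[OF V'] using E2[OF W(2)] E3 by (intro sum.cong) auto
  also have "\<dots> = g (F p) (\<lambda>f. t (\<lambda>q. V q f)) (V' p) + g (F p) (V p) (\<lambda>f. t (\<lambda>q. V' q f))"
  proof -
    have "(\<lambda>f. t (\<lambda>q. V' q f)) \<in> tangent_space B (F p)"
      unfolding deriv[OF V'] by (rule tangent_sum[OF B finite_Basis Ep])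
    note metric_frame(1)[OF B g fr W(3)[OF W(2)] field_tangent[OF V] this]
    moreover have "g (F p) (\<lambda>f. t (\<lambda>q. V q f)) (V' p) =
        (\<Sum>i\<in>Basis. t (\<lambda>q. V q (y i)) * g (F p) (E i (F p)) (V' p))"
      unfolding deriv[OF V] by (rule metric_sum[OF B g field_tangent[OF V'] finite_Basis Ep])
    ultimately show ?thesis by simp
  qed
  finally show "t (\<lambda>q. g (F q) (V q) (V' q)) =
      g (F p) (\<lambda>f. t (\<lambda>q. V q f)) (V' p) + g (F p) (V p) (\<lambda>f. t (\<lambda>q. V' q f))" .
qed

lemma connection_facts:
  assumes "connection_along A B F D" "X \<in> vector_fields A" "V \<in> fields_along A B F"
  shows "D X V \<in> fields_along A B F"
    "W \<in> fields_along A B F \<Longrightarrow>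
       D X (\<lambda>p. lincomb 1 (V p) 1 (W p)) = (\<lambda>p. lincomb 1 (D X V p) 1 (D X W p))"
    "a \<in> smooth_funs A \<Longrightarrow> D X (\<lambda>p f. a p * V p f) = (\<lambda>p. lincomb (X p a) (V p) (a p) (D X V p))"
  using assms unfolding connection_along_def by blast+

lemma connection_zero:
  assumes D: "connection_along A B F D" and X: "X \<in> vector_fields A"
  shows "D X (\<lambda>p f. 0) p f = 0"
proof -
  have "D X (\<lambda>p f. 0 * 0) = (\<lambda>p. lincomb (X p (\<lambda>p. 0)) (\<lambda>f. 0) 0 (D X (\<lambda>p f. 0) p))"
    by (rule connection_facts(3)[OF D X field_zero[OF A B] smooth_funs_const[OF A]])
  then show ?thesis by (simp add: lincomb_def fun_eq_iff)
qed

lemma connection_sum: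
  assumes D: "connection_along A B F D" and X: "X \<in> vector_fields A" and "finite I"
    "\<And>i. i \<in> I \<Longrightarrow> V i \<in> fields_along A B F" "\<And>i. i \<in> I \<Longrightarrow> a i \<in> smooth_funs A"
  shows "D X (\<lambda>p f. \<Sum>i\<in>I. a i p * V i p f) p f =
    (\<Sum>i\<in>I. X p (a i) * V i p f + a i p * D X (V i) p f)"
  using assms(3-5)
proof (induction I rule: finite_induct)
  case empty
  then show ?case using connection_zero[OF D X] by simp
next
  case (insert i I)
  let ?S = "\<lambda>p f. \<Sum>i\<in>I. a i p * V i p f" and ?T = "\<lambda>p f. a i p * V i p f"
  have S: "?S \<in> fields_along A B F" by (rule field_sum[OF A B insert.hyps(1)]) (use insert in auto)
  have T: "?T \<in> fields_along A B F" by (rule field_scale[OF A B]) (use insert in auto)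
  have "(\<lambda>p f. \<Sum>i\<in>insert i I. a i p * V i p f) = (\<lambda>p. lincomb 1 (?T p) 1 (?S p))"
    using insert by (simp add: lincomb_def)
  then have "D X (\<lambda>p f. \<Sum>i\<in>insert i I. a i p * V i p f) p f = D X ?T p f + D X ?S p f"
    using connection_facts(2)[OF D X T S] by (simp add: lincomb_def)
  moreover have "D X ?T p f = X p (a i) * V i p f + a i p * D X (V i) p f"
    using connection_facts(3)[OF D X, of "V i" "a i"] insert by (simp add: lincomb_def)
  ultimately show ?case using insert by simp
qed

text \<open>
Only the value of the cutoff function \<open>\<psi>\<close> near \<open>F p\<close>, where it is 1, contributes: the Leibniz rule shows
that the connection does not notice the factor, and it can then be applied to the global expansion.
\<close>

lemma connection_frame:
  assumes D: "connection_along A B F D" and X: "X \<in> vector_fields A" and V: "V \<in> fields_along A B F"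
    and fr: "local_frame B (F p) E y \<psi>"
  shows "D X V p f =
    (\<Sum>i\<in>Basis. X p (\<lambda>q. V q (y i)) * E i (F p) f + V p (y i) * D X (\<lambda>q. E i (F q)) p f)"
proof -
  obtain W where W: "open W" "p \<in> W" "\<And>q. q \<in> W \<Longrightarrow> \<psi> (F q) = 1"
    by (rule local_frame_neighbourhood[OF fr smooth_map_continuous[OF F]]) blast
  note E = local_frame_facts(1)[OF fr] and y = local_frame_facts(2)[OF fr]
  have Xp: "X p \<in> tangent_space A p" by (rule field_tangent[OF X])
  let ?a = "\<lambda>i q. \<psi> (F q) * V q (y i)"
  have s\<psi>: "(\<lambda>q. \<psi> (F q)) \<in> smooth_funs A"
    by (rule smooth_funs_compose[OF A B F local_frame_facts(3)[OF fr]])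
  have sV: "(\<lambda>q. V q (y i)) \<in> smooth_funs A" if "i \<in> Basis" for i
    by (rule field_smooth[OF V y[OF that]])
  have sa: "?a i \<in> smooth_funs A" if "i \<in> Basis" for i
    by (rule smooth_funs_mult[OF A s\<psi> sV[OF that]])
  have EF: "(\<lambda>q. E i (F q)) \<in> fields_along A B F" if "i \<in> Basis" for i
    by (rule field_along_restrict[OF A B F E[OF that]])
  have "X p (\<lambda>q. \<psi> (F q)) = X p (\<lambda>q. 1)"
    by (rule tangent_local[OF A Xp s\<psi> smooth_funs_const[OF A] W])
  also have "\<dots> = 0" by (rule tangent_fun_const[OF A Xp])
  finally have X\<psi>: "X p (\<lambda>q. \<psi> (F q)) = 0" .
  have Xa: "X p (?a i) = X p (\<lambda>q. V q (y i))" if "i \<in> Basis" for i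
    by (rule tangent_local[OF A Xp sa[OF that] sV[OF that] W(1,2)]) (simp add: W(3))
  have "D X (\<lambda>q f. \<psi> (F q) * V q f) p f = D X V p f"
    using connection_facts(3)[OF D X V s\<psi>] X\<psi> W(2,3) by (simp add: lincomb_def)
  moreover have "(\<lambda>q f. \<psi> (F q) * V q f) = (\<lambda>q f. \<Sum>i\<in>Basis. ?a i q * E i (F q) f)"
    by (intro ext) (rule local_frame_facts(4)[OF fr field_tangent[OF V]])
  moreover have "D X (\<lambda>q f. \<Sum>i\<in>Basis. ?a i q * E i (F q) f) p f =
      (\<Sum>i\<in>Basis. X p (?a i) * E i (F p) f + ?a i p * D X (\<lambda>q. E i (F q)) p f)"
    by (rule connection_sum[OF D X finite_Basis EF sa])
  moreover have "\<dots> = (\<Sum>i\<in>Basis. X p (\<lambda>q. V q (y i)) * E i (F p) f + V p (y i) * D X (\<lambda>q. E i (F q)) p f)"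
    using W(3)[OF W(2)] by (intro sum.cong) (simp_all add: Xa)
  ultimately show ?thesis by simp
qed

end

lemma levi_civita_facts:
  assumes "levi_civita A g D"
  shows "affine_connection A D"
    "X \<in> vector_fields A \<Longrightarrow> Y \<in> vector_fields A \<Longrightarrow> lincomb 1 (D X Y p) (-1) (D Y X p) = lie_bracket A X Y p"
    "X \<in> vector_fields A \<Longrightarrow> Y \<in> vector_fields A \<Longrightarrow> Z \<in> vector_fields A \<Longrightarrow>
      X p (\<lambda>q. g q (Y q) (Z q)) = g p (D X Y p) (Z p) + g p (Y p) (D X Z p)"
  using assms unfolding levi_civita_def by blast+

lemma levi_civita_field:
  assumes "levi_civita A g D" "X \<in> vector_fields A" "Y \<in> vector_fields A"
  shows "D X Y \<in> vector_fields A"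
  using levi_civita_facts(1)[OF assms(1)] assms(2,3) unfolding connection_along_def by blast

lemma lie_bracket_tangent:
  assumes "smooth_atlas A" "levi_civita A g D" "X \<in> vector_fields A" "Y \<in> vector_fields A"
  shows "lie_bracket A X Y p \<in> tangent_space A p"
  unfolding levi_civita_facts(2)[OF assms(2-4), symmetric]
  by (intro tangent_lincomb assms(1) field_tangent[OF levi_civita_field[OF assms(2)]] assms(3,4))

context
  fixes A :: "('a::{t2_space,second_countable_topology}, 'e::euclidean_space) chart set"
    and B :: "('b::{t2_space,second_countable_topology}, 'f::euclidean_space) chart set"
    and F :: "'a \<Rightarrow> 'b" and g :: "'b \<Rightarrow> 'b tangent \<Rightarrow> 'b tangent \<Rightarrow> real"
    and D :: "('b \<Rightarrow> 'b tangent) \<Rightarrow> ('b \<Rightarrow> 'b tangent) \<Rightarrow> 'b \<Rightarrow> 'b tangent"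
    and DF :: "('a \<Rightarrow> 'a tangent) \<Rightarrow> ('a \<Rightarrow> 'b tangent) \<Rightarrow> 'a \<Rightarrow> 'b tangent"
  assumes A: "smooth_atlas A" and B: "smooth_atlas B" and F: "smooth_map A B F"
    and g: "riemannian_metric B g" and D: "levi_civita B g D" and DF: "pullback_connection A B F D DF"
begin

lemma pullback_eq:
  assumes "X \<in> vector_fields A" "W \<in> vector_fields B" "Y \<in> vector_fields B" "W (F p) = differential B F (X p)"
  shows "DF X (\<lambda>q. Y (F q)) p = D W Y (F p)"
  using DF assms unfolding pullback_connection_def by blast

text \<open>
On the fields \<open>E i\<close> of a local frame the pullback connection is the ambient one, for which the metric is
parallel; the coefficients of \<open>V\<close> only contribute through the Leibniz rule.
\<close>

lemma pullback_metric:
  assumes X: "X \<in> vector_fields A" and V: "V \<in> fields_along A B F" and Y: "Y \<in> vector_fields B"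
  shows "X p (\<lambda>q. g (F q) (V q) (Y (F q))) =
    g (F p) (DF X V p) (Y (F p)) + g (F p) (V p) (DF X (\<lambda>q. Y (F q)) p)"
proof -
  have con: "connection_along A B F DF" using DF by (simp add: pullback_connection_def)
  obtain E y \<psi> where fr: "local_frame B (F p) E y \<psi>" by (rule local_frame_exists[OF B])
  from local_frame_neighbourhood[OF fr smooth_map_continuous[OF F]]
  obtain W where W: "open W" "p \<in> W" "\<And>q. q \<in> W \<Longrightarrow> \<psi> (F q) = 1" by blast
  note E = local_frame_facts(1)[OF fr] and y = local_frame_facts(2)[OF fr]
  have Xp: "X p \<in> tangent_space A p" by (rule field_tangent[OF X])
  obtain T where T: "T \<in> vector_fields B" "T (F p) = differential B F (X p)"
    by (rule field_extension[OF B differential_tangent[OF A B F Xp]])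
  let ?g = "\<lambda>i q. g (F q) (E i (F q)) (Y (F q))"
  have gY: "(\<lambda>r. g r (E i r) (Y r)) \<in> smooth_funs B" if "i \<in> Basis" for i
    by (rule metric_smooth[OF g E[OF that] Y])
  have sg: "?g i \<in> smooth_funs A" if "i \<in> Basis" for i
    using smooth_funs_compose[OF A B F gY[OF that]] .
  have sV: "(\<lambda>q. V q (y i)) \<in> smooth_funs A" if "i \<in> Basis" for i
    by (rule field_smooth[OF V y[OF that]])
  have sVg: "(\<lambda>q. V q (y i) * ?g i q) \<in> smooth_funs A" if "i \<in> Basis" for i
    by (rule smooth_funs_mult[OF A sV[OF that] sg[OF that]])
  have DE: "DF X (\<lambda>q. E i (F q)) p = D T (E i) (F p)" if "i \<in> Basis" for i
    by (rule pullback_eq[OF X T(1) E[OF that] T(2)])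
  have DY: "DF X (\<lambda>q. Y (F q)) p = D T Y (F p)" by (rule pullback_eq[OF X T(1) Y T(2)])
  have Xg: "X p (?g i) = g (F p) (D T (E i) (F p)) (Y (F p)) + g (F p) (E i (F p)) (D T Y (F p))"
    if "i \<in> Basis" for i
  proof -
    have "X p (?g i) = T (F p) (\<lambda>r. g r (E i r) (Y r))"
      using gY[OF that] by (simp add: T(2) differential_def comp_def)
    then show ?thesis using levi_civita_facts(3)[OF D T(1) E[OF that] Y] by simp
  qed
  have tan: "E i (F p) \<in> tangent_space B (F p)" "D T (E i) (F p) \<in> tangent_space B (F p)" if "i \<in> Basis" for i
    using field_tangent[OF E[OF that]] field_tangent[OF levi_civita_field[OF D T(1) E[OF that]]] .
  have tY: "Y (F p) \<in> tangent_space B (F p)" "D T Y (F p) \<in> tangent_space B (F p)"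
    using field_tangent[OF Y] field_tangent[OF levi_civita_field[OF D T(1) Y]] .
  have "X p (\<lambda>q. g (F q) (V q) (Y (F q))) = X p (\<lambda>q. \<Sum>i\<in>Basis. V q (y i) * ?g i q)"
    by (rule tangent_local[OF A Xp metric_along_smooth[OF A B F g V field_along_restrict[OF A B F Y]]
          smooth_funs_sum[OF A finite_Basis sVg] W(1,2)
          metric_frame(1)[OF B g fr W(3) field_tangent[OF V] field_tangent[OF Y]]])
  also have "\<dots> = (\<Sum>i\<in>Basis. X p (\<lambda>q. V q (y i) * ?g i q))"
    by (rule tangent_fun_sum[OF A Xp finite_Basis sVg])
  also have "\<dots> = (\<Sum>i\<in>Basis. X p (\<lambda>q. V q (y i)) * g (F p) (E i (F p)) (Y (F p)) +
        V p (y i) * g (F p) (D T (E i) (F p)) (Y (F p)))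
      + (\<Sum>i\<in>Basis. V p (y i) * g (F p) (E i (F p)) (D T Y (F p)))"
    unfolding sum.distrib[symmetric]
    using tangent_fun_mult[OF A Xp sV sg] Xg by (intro sum.cong) (auto simp: algebra_simps)
  also have "(\<Sum>i\<in>Basis. V p (y i) * g (F p) (E i (F p)) (D T Y (F p))) = g (F p) (V p) (DF X (\<lambda>q. Y (F q)) p)"
    unfolding DY by (rule metric_frame(1)[OF B g fr W(3)[OF W(2)] field_tangent[OF V] tY(2), symmetric])
  also have "(\<Sum>i\<in>Basis. X p (\<lambda>q. V q (y i)) * g (F p) (E i (F p)) (Y (F p)) +
        V p (y i) * g (F p) (D T (E i) (F p)) (Y (F p))) = g (F p) (DF X V p) (Y (F p))"
  proof -
    have "DF X V p = lincomb 1 (\<lambda>f. \<Sum>i\<in>Basis. X p (\<lambda>q. V q (y i)) * E i (F p) f)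
        1 (\<lambda>f. \<Sum>i\<in>Basis. V p (y i) * D T (E i) (F p) f)"
      unfolding fun_eq_iff connection_frame[OF A B F con X V fr]
      by (simp add: lincomb_def sum.distrib DE)
    moreover have "(\<lambda>f. \<Sum>i\<in>Basis. X p (\<lambda>q. V q (y i)) * E i (F p) f) \<in> tangent_space B (F p)"
      "(\<lambda>f. \<Sum>i\<in>Basis. V p (y i) * D T (E i) (F p) f) \<in> tangent_space B (F p)"
      by - (rule tangent_sum[OF B finite_Basis tan(1)], assumption,
          rule tangent_sum[OF B finite_Basis tan(2)], assumption)
    moreover have "g (F p) (\<lambda>f. \<Sum>i\<in>Basis. X p (\<lambda>q. V q (y i)) * E i (F p) f) (Y (F p)) =
        (\<Sum>i\<in>Basis. X p (\<lambda>q. V q (y i)) * g (F p) (E i (F p)) (Y (F p)))"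
      "g (F p) (\<lambda>f. \<Sum>i\<in>Basis. V p (y i) * D T (E i) (F p) f) (Y (F p)) =
        (\<Sum>i\<in>Basis. V p (y i) * g (F p) (D T (E i) (F p)) (Y (F p)))"
      by - (rule metric_sum[OF B g tY(1) finite_Basis tan(1)], assumption,
          rule metric_sum[OF B g tY(1) finite_Basis tan(2)], assumption)
    ultimately show ?thesis
      using metric_facts(1)[OF g _ _ tY(1)] by (simp add: sum.distrib)
  qed
  finally show ?thesis .
qed

text \<open>
If \<open>X\<close> is mapped to the restriction of an ambient field \<open>Y\<close>, and \<open>W\<close> extends the image of \<open>Z\<close> at \<open>p\<close>, then
\<open>DF Z Y = D W Y = D Y W + [W, Y]\<close>. In a local frame the connection terms of \<open>D Y W\<close> and of
\<open>DF X (dF Z)\<close> agree, because \<open>W\<close> and the image of \<open>Z\<close> agree at \<open>p\<close>. The derivatives of the components of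
\<open>W\<close>, which do depend on the extension, cancel against \<open>[W, Y]\<close> and leave the image of \<open>[Z, X]\<close>.
\<close>

lemma pullback_torsion_free:
  assumes Z: "Z \<in> vector_fields A" and X: "X \<in> vector_fields A" and Y: "Y \<in> vector_fields B"
    and rel: "\<And>q. differential B F (X q) = Y (F q)"
    and br: "lie_bracket A Z X p \<in> tangent_space A p"
  shows "DF Z (\<lambda>q. Y (F q)) p f =
    DF X (\<lambda>q. differential B F (Z q)) p f + differential B F (lie_bracket A Z X p) f"
proof -
  have con: "connection_along A B F DF" using DF by (simp add: pullback_connection_def)
  let ?V = "\<lambda>q. differential B F (Z q)"
  have V: "?V \<in> fields_along A B F" by (rule field_along_differential[OF A B F Z])
  obtain E y \<psi> where fr: "local_frame B (F p) E y \<psi>" by (rule local_frame_exists[OF B])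
  have \<psi>: "\<psi> (F p) = 1" using fr unfolding local_frame_def by blast
  note E = local_frame_facts(1)[OF fr] and y = local_frame_facts(2)[OF fr]
  obtain W where W: "W \<in> vector_fields B" "W (F p) = ?V p"
    by (rule field_extension[OF B field_tangent[OF V]])
  have DE: "DF X (\<lambda>q. E i (F q)) p = D Y (E i) (F p)" if "i \<in> Basis" for i
    by (rule pullback_eq[OF X Y E[OF that]]) (simp add: rel)
  have dX: "X q (\<lambda>r. h (F r)) = Y (F q) h" if "h \<in> smooth_funs B" for h q
    using that by (simp add: rel[symmetric] differential_def comp_def)
  have dZ: "?V q h = Z q (\<lambda>r. h (F r))" if "h \<in> smooth_funs B" for h q
    using that by (simp add: differential_def comp_def)
  have "DF Z (\<lambda>q. Y (F q)) p = D W Y (F p)" by (rule pullback_eq[OF Z W(1) Y W(2)])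
  then have 1: "DF Z (\<lambda>q. Y (F q)) p f = D Y W (F p) f + lie_bracket B W Y (F p) f"
    using fun_cong[OF levi_civita_facts(2)[OF D W(1) Y, of "F p"], of f] by (simp add: lincomb_def)
  have 2: "lie_bracket B W Y (F p) f = (\<Sum>i\<in>Basis. (Z p (\<lambda>q. Y (F q) (y i)) - Y (F p) (\<lambda>r. W r (y i))) * E i (F p) f)"
    unfolding local_frame_expand[OF fr \<psi> lie_bracket_tangent[OF B D W(1) Y], of f]
    using y dZ[OF field_smooth[OF Y y]] by (intro sum.cong) (auto simp: lie_bracket_def W(2))
  have 3: "D Y W (F p) f = (\<Sum>i\<in>Basis. Y (F p) (\<lambda>r. W r (y i)) * E i (F p) f + ?V p (y i) * D Y (E i) (F p) f)"
    using connection_frame[OF B B smooth_map_ident[OF B] levi_civita_facts(1)[OF D] Y W(1) fr, of f]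
    by (simp add: W(2))
  have 4: "DF X ?V p f = (\<Sum>i\<in>Basis. X p (\<lambda>q. Z q (\<lambda>r. y i (F r))) * E i (F p) f + ?V p (y i) * D Y (E i) (F p) f)"
    unfolding connection_frame[OF A B F con X V fr] using DE dZ[OF y] by (intro sum.cong) auto
  have 5: "differential B F (lie_bracket A Z X p) f =
      (\<Sum>i\<in>Basis. (Z p (\<lambda>q. Y (F q) (y i)) - X p (\<lambda>q. Z q (\<lambda>r. y i (F r)))) * E i (F p) f)"
    unfolding local_frame_expand[OF fr \<psi> differential_tangent[OF A B F br], of f]
    using y dX[OF y] smooth_funs_compose[OF A B F y]
    by (intro sum.cong) (auto simp: differential_def lie_bracket_def comp_def)
  show ?thesis
    unfolding 1 2 3 4 5 sum.distrib[symmetric]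
    by (intro sum.cong) (auto simp: algebra_simps)
qed

end

section \<open>The characteristic vector field of a nearly Sasakian manifold\<close>

context
  fixes M :: "('a::{t2_space,second_countable_topology}, 'e::euclidean_space) chart set"
    and \<phi> \<xi> \<eta> g D \<alpha>
  assumes M: "smooth_atlas M" and ns: "nearly_sasakian M \<phi> \<xi> \<eta> g D \<alpha>"
begin

lemma contact_metric: "almost_contact_metric M \<phi> \<xi> \<eta> g"
  and contact_levi_civita: "levi_civita M g D"
  and nearly_sasakian_eq: "X \<in> vector_fields M \<Longrightarrow> Y \<in> vector_fields M \<Longrightarrow>
    lincomb 1 (cov_deriv_tensor11 D \<phi> X Y p) 1 (cov_deriv_tensor11 D \<phi> Y X p) =
      (\<lambda>f. \<alpha> p * (2 * g p (X p) (Y p) * \<xi> p f - \<eta> p (Y p) * X p f - \<eta> p (X p) * Y p f))"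
  using ns unfolding nearly_sasakian_def by blast+

lemma contact_riemannian: "riemannian_metric M g"
  and xi_field: "\<xi> \<in> vector_fields M"
  and phi_tensor: "tensor11 M \<phi>"
  and phi_phi: "u \<in> tangent_space M p \<Longrightarrow> \<phi> p (\<phi> p u) = lincomb (-1) u (\<eta> p u) (\<xi> p)"
  and phi_xi: "\<phi> p (\<xi> p) = zero_vector"
  and eta_phi: "u \<in> tangent_space M p \<Longrightarrow> \<eta> p (\<phi> p u) = 0"
  and eta_xi: "\<eta> p (\<xi> p) = 1"
  and eta_eq: "u \<in> tangent_space M p \<Longrightarrow> \<eta> p u = g p u (\<xi> p)"
  and g_phi_phi: "u \<in> tangent_space M p \<Longrightarrow> v \<in> tangent_space M p \<Longrightarrow>
    g p (\<phi> p u) (\<phi> p v) = g p u v - \<eta> p u * \<eta> p v"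
  using contact_metric unfolding almost_contact_metric_def by blast+

lemma phi_tangent: "u \<in> tangent_space M p \<Longrightarrow> \<phi> p u \<in> tangent_space M p"
  and phi_field: "X \<in> vector_fields M \<Longrightarrow> (\<lambda>p. \<phi> p (X p)) \<in> vector_fields M"
  using phi_tensor unfolding tensor11_def by blast+

lemma xi_tangent: "\<xi> p \<in> tangent_space M p"
  by (rule field_tangent[OF xi_field])

text \<open>
Compare \<open>g (\<phi> u) (\<phi> (\<phi> v))\<close> computed from the compatibility of \<open>g\<close> with \<open>\<phi>\<close> and from \<open>\<phi>\<^sup>2 = -I + \<eta> \<otimes> \<xi>\<close>.
\<close>

lemma phi_skew:
  assumes u: "u \<in> tangent_space M p" and v: "v \<in> tangent_space M p"
  shows "g p (\<phi> p u) v = - g p u (\<phi> p v)"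
proof -
  have "g p (\<phi> p u) (\<phi> p (\<phi> p v)) = - g p (\<phi> p u) v"
    using metric_facts(3)[OF contact_riemannian v xi_tangent phi_tangent[OF u] M] eta_phi[OF u]
      eta_eq[OF phi_tangent[OF u]]
    by (simp add: phi_phi[OF v])
  moreover have "g p (\<phi> p u) (\<phi> p (\<phi> p v)) = g p u (\<phi> p v)"
    using g_phi_phi[OF u phi_tangent[OF v]] eta_phi[OF v] by simp
  ultimately show ?thesis by simp
qed

lemma g_phi_self: "u \<in> tangent_space M p \<Longrightarrow> g p (\<phi> p u) u = 0"
  using phi_skew[of u p u] metric_facts(2)[OF contact_riemannian phi_tangent[of u p], of u u] by simp

lemma D_tangent: "X \<in> vector_fields M \<Longrightarrow> Y \<in> vector_fields M \<Longrightarrow> D X Y p \<in> tangent_space M p"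
  by (rule field_tangent[OF levi_civita_field[OF contact_levi_civita]])

lemma D_xi_orthogonal: "X \<in> vector_fields M \<Longrightarrow> \<eta> p (D X \<xi> p) = 0"
proof -
  assume X: "X \<in> vector_fields M"
  have "g q (\<xi> q) (\<xi> q) = 1" for q using eta_eq[OF xi_tangent] eta_xi by simp
  then have "X p (\<lambda>q. g q (\<xi> q) (\<xi> q)) = 0"
    using tangent_fun_const[OF M field_tangent[OF X]]
    by simp
  moreover have "g p (\<xi> p) (D X \<xi> p) = g p (D X \<xi> p) (\<xi> p)"
    using metric_facts(2)[OF contact_riemannian xi_tangent D_tangent[OF X xi_field] xi_tangent] .
  ultimately show ?thesis
    using levi_civita_facts(3)[OF contact_levi_civita X xi_field xi_field, of p] eta_eq[OF D_tangent[OF X xi_field]]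
    by simp
qed

lemma D_phi_xi:
  assumes X: "X \<in> vector_fields M"
  shows "cov_deriv_tensor11 D \<phi> X \<xi> p = (\<lambda>f. - \<phi> p (D X \<xi> p) f)"
proof -
  have "D X (\<lambda>q. \<phi> q (\<xi> q)) p f = 0" for f
    using connection_zero[OF M M smooth_map_ident[OF M] levi_civita_facts(1)[OF contact_levi_civita] X]
    by (simp add: phi_xi zero_vector_def)
  then show ?thesis by (simp add: cov_deriv_tensor11_def lincomb_def)
qed

text \<open>
The nearly Sasakian condition for the pair \<open>X\<close>, \<open>\<xi>\<close>, solved for \<open>\<phi> (\<nabla>\<^sub>X \<xi>)\<close>, which is the negative of
\<open>(\<nabla>\<^sub>X \<phi>) \<xi>\<close> because \<open>\<phi> \<xi> = 0\<close>.
\<close>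

lemma phi_D_xi:
  assumes X: "X \<in> vector_fields M"
  shows "\<phi> p (D X \<xi> p) = lincomb 1 (lincomb 1 (D \<xi> (\<lambda>q. \<phi> q (X q)) p) (-1) (\<phi> p (D \<xi> X p)))
    1 (lincomb (\<alpha> p) (X p) (- \<alpha> p * \<eta> p (X p)) (\<xi> p))"
proof
  fix f
  have "cov_deriv_tensor11 D \<phi> \<xi> X p f - \<phi> p (D X \<xi> p) f =
      \<alpha> p * (\<eta> p (X p) * \<xi> p f - X p f)"
    using fun_cong[OF nearly_sasakian_eq[OF X xi_field, of p], of f] eta_eq[OF field_tangent[OF X]] eta_xi
    by (simp add: lincomb_def D_phi_xi[OF X] algebra_simps)
  then show "\<phi> p (D X \<xi> p) f = lincomb 1 (lincomb 1 (D \<xi> (\<lambda>q. \<phi> q (X q)) p) (-1) (\<phi> p (D \<xi> X p)))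
    1 (lincomb (\<alpha> p) (X p) (- \<alpha> p * \<eta> p (X p)) (\<xi> p)) f"
    by (simp add: lincomb_def cov_deriv_tensor11_def algebra_simps)
qed

lemma g_phi_D_xi:
  assumes X: "X \<in> vector_fields M" and v: "v \<in> tangent_space M p"
  shows "g p (\<phi> p (D X \<xi> p)) v = g p (D \<xi> (\<lambda>q. \<phi> q (X q)) p) v - g p (\<phi> p (D \<xi> X p)) v
    + \<alpha> p * (g p (X p) v - \<eta> p (X p) * \<eta> p v)"
proof -
  note lin = metric_facts(1)[OF contact_riemannian _ _ v] and Xp = field_tangent[OF X]
  have 1: "D \<xi> (\<lambda>q. \<phi> q (X q)) p \<in> tangent_space M p" "\<phi> p (D \<xi> X p) \<in> tangent_space M p"
    using D_tangent[OF xi_field phi_field[OF X]] phi_tangent[OF D_tangent[OF xi_field X]] .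
  have "g p (\<phi> p (D X \<xi> p)) v =
      g p (lincomb 1 (D \<xi> (\<lambda>q. \<phi> q (X q)) p) (-1) (\<phi> p (D \<xi> X p))) v
      + g p (lincomb (\<alpha> p) (X p) (- \<alpha> p * \<eta> p (X p)) (\<xi> p)) v"
    unfolding phi_D_xi[OF X] using lin[OF tangent_lincomb[OF M 1] tangent_lincomb[OF M Xp xi_tangent]] by simp
  moreover have "g p (\<xi> p) v = \<eta> p v"
    using metric_facts(2)[OF contact_riemannian xi_tangent v v] eta_eq[OF v] by simp
  ultimately show ?thesis
    using lin[OF 1] lin[OF Xp xi_tangent] by (simp add: algebra_simps)
qed

text \<open>
For \<open>X = \<xi>\<close> the nearly Sasakian condition gives \<open>\<phi> (\<nabla>\<^sub>\<xi> \<xi>) = 0\<close>, and \<open>\<nabla>\<^sub>\<xi> \<xi>\<close> is orthogonal to the unit field \<open>\<xi>\<close>.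
\<close>

lemma D_xi_xi: "D \<xi> \<xi> p = zero_vector"
proof -
  let ?u = "D \<xi> \<xi> p"
  have u: "?u \<in> tangent_space M p" by (rule D_tangent[OF xi_field xi_field])
  have 0: "D \<xi> (\<lambda>q. \<phi> q (\<xi> q)) p = zero_vector"
    using connection_zero[OF M M smooth_map_ident[OF M] levi_civita_facts(1)[OF contact_levi_civita] xi_field]
    by (simp add: phi_xi zero_vector_def fun_eq_iff)
  have "g p (\<phi> p ?u) (\<phi> p ?u) = - g p (\<phi> p ?u) (\<phi> p ?u)"
    using g_phi_D_xi[OF xi_field phi_tangent[OF u]] metric_zero(1)[OF M contact_riemannian phi_tangent[OF u]]
      eta_phi[OF u] metric_facts(2)[OF contact_riemannian xi_tangent phi_tangent[OF u] u]
      eta_eq[OF phi_tangent[OF u]] eta_xi by (simp add: 0)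
  then have "\<phi> p ?u = zero_vector"
    by (intro metric_definite[OF contact_riemannian phi_tangent[OF u]]) simp
  then have "g p ?u ?u = 0"
    using g_phi_phi[OF u u] D_xi_orthogonal[OF xi_field] metric_zero(1)[OF M contact_riemannian tangent_zero[OF M]]
    by simp
  then show ?thesis by (rule metric_definite[OF contact_riemannian u])
qed

text \<open>
Since \<open>\<nabla>\<^sub>X \<xi>\<close> is orthogonal to \<open>\<xi>\<close>, its product with \<open>X\<close> is that of \<open>\<phi> (\<nabla>\<^sub>X \<xi>)\<close> with \<open>\<phi> X\<close>. There \<open>\<alpha>\<close> drops
out, because \<open>\<phi> X\<close> is orthogonal to \<open>X\<close> and to \<open>\<xi>\<close>. What remains is half the derivative along \<open>\<xi>\<close> of
\<open>|\<phi> X|\<^sup>2 - |X|\<^sup>2 + (\<eta> X)\<^sup>2 = 0\<close>, where \<open>\<nabla>\<^sub>\<xi> \<xi> = 0\<close> identifies \<open>\<eta> (\<nabla>\<^sub>\<xi> X)\<close> with \<open>\<xi> (\<eta> X)\<close>.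
\<close>

lemma xi_Killing_diagonal:
  assumes X: "X \<in> vector_fields M"
  shows "g p (D X \<xi> p) (X p) = 0"
proof -
  note R = contact_riemannian and Xp = field_tangent[OF X] and L = levi_civita_facts(3)[OF contact_levi_civita]
  note sym = metric_facts(2)[OF R]
  let ?\<phi>X = "\<lambda>q. \<phi> q (X q)"
  have \<phi>X: "?\<phi>X \<in> vector_fields M" by (rule phi_field[OF X])
  have DX: "D \<xi> X p \<in> tangent_space M p" and D\<phi>X: "D \<xi> ?\<phi>X p \<in> tangent_space M p"
    using D_tangent[OF xi_field X] D_tangent[OF xi_field \<phi>X] .
  have X\<eta>: "(\<lambda>q. \<eta> q (X q)) \<in> smooth_funs M"
    using metric_smooth[OF R X xi_field] eta_eq[OF field_tangent[OF X]] by simp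
  have XX: "(\<lambda>q. g q (X q) (X q)) \<in> smooth_funs M" by (rule metric_smooth[OF R X X])
  have "g p (D X \<xi> p) (X p) = g p (\<phi> p (D X \<xi> p)) (\<phi> p (X p))"
    using g_phi_phi[OF D_tangent[OF X xi_field] Xp] D_xi_orthogonal[OF X] by simp
  also have "\<dots> = g p (D \<xi> ?\<phi>X p) (\<phi> p (X p)) - g p (\<phi> p (D \<xi> X p)) (\<phi> p (X p))"
    using g_phi_D_xi[OF X phi_tangent[OF Xp]] eta_phi[OF Xp] g_phi_self[OF Xp] sym[OF Xp phi_tangent[OF Xp] Xp]
    by simp
  also have "g p (\<phi> p (D \<xi> X p)) (\<phi> p (X p)) = g p (D \<xi> X p) (X p) - \<eta> p (D \<xi> X p) * \<eta> p (X p)"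
    by (rule g_phi_phi[OF DX Xp])
  finally have 1: "g p (D X \<xi> p) (X p) =
    g p (D \<xi> ?\<phi>X p) (\<phi> p (X p)) - g p (D \<xi> X p) (X p) + \<eta> p (D \<xi> X p) * \<eta> p (X p)" by simp
  have 2: "\<xi> p (\<lambda>q. g q (?\<phi>X q) (?\<phi>X q)) = 2 * g p (D \<xi> ?\<phi>X p) (\<phi> p (X p))"
    using L[OF xi_field \<phi>X \<phi>X, of p] sym[OF D\<phi>X phi_tangent[OF Xp] Xp] by simp
  have 3: "\<xi> p (\<lambda>q. g q (X q) (X q)) = 2 * g p (D \<xi> X p) (X p)"
    using L[OF xi_field X X, of p] sym[OF DX Xp Xp] by simp
  have 4: "\<xi> p (\<lambda>q. \<eta> q (X q)) = \<eta> p (D \<xi> X p)"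
    using L[OF xi_field X xi_field, of p] metric_zero(2)[OF M R Xp] eta_eq[OF field_tangent[OF X]] eta_eq[OF DX]
    by (simp add: D_xi_xi)
  have "(\<lambda>q. g q (?\<phi>X q) (?\<phi>X q)) = (\<lambda>q. g q (X q) (X q) + (-1) * (\<eta> q (X q) * \<eta> q (X q)))"
    using g_phi_phi[OF field_tangent[OF X] field_tangent[OF X]] by simp
  then have "\<xi> p (\<lambda>q. g q (?\<phi>X q) (?\<phi>X q)) =
      \<xi> p (\<lambda>q. g q (X q) (X q)) - 2 * \<eta> p (X p) * \<xi> p (\<lambda>q. \<eta> q (X q))"
    using tangent_fun_add[OF M xi_tangent XX smooth_funs_mult[OF M smooth_funs_const[OF M, where k = "-1"] smooth_funs_mult[OF M X\<eta> X\<eta>]]]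
      tangent_fun_cmult[OF M xi_tangent smooth_funs_mult[OF M X\<eta> X\<eta>], where k = "-1"]
      tangent_fun_mult[OF M xi_tangent X\<eta> X\<eta>] by simp
  then show ?thesis using 1 2 3 4 by (simp add: algebra_simps)
qed

lemma xi_Killing:
  assumes X: "X \<in> vector_fields M" and Y: "Y \<in> vector_fields M"
  shows "g p (D X \<xi> p) (Y p) + g p (D Y \<xi> p) (X p) = 0"
proof -
  note R = contact_riemannian
  let ?S = "\<lambda>p. lincomb 1 (X p) 1 (Y p)"
  have S: "?S \<in> vector_fields M"
    using field_lincomb[OF M M X Y smooth_funs_const[OF M, of 1] smooth_funs_const[OF M, of 1]] .
  have "D ?S \<xi> = (\<lambda>p. lincomb 1 (D X \<xi> p) 1 (D Y \<xi> p))"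
  proof -
    have "\<forall>X\<in>vector_fields M. \<forall>Y\<in>vector_fields M. \<forall>V\<in>vector_fields M.
        \<forall>a\<in>smooth_funs M. \<forall>b\<in>smooth_funs M.
          D (\<lambda>p. lincomb (a p) (X p) (b p) (Y p)) V = (\<lambda>p. lincomb (a p) (D X V p) (b p) (D Y V p))"
      using levi_civita_facts(1)[OF contact_levi_civita] unfolding connection_along_def by (elim conjE)
    from this[rule_format, OF X Y xi_field smooth_funs_const[OF M, of 1] smooth_funs_const[OF M, of 1]]
    show ?thesis .
  qed
  then have "g p (lincomb 1 (D X \<xi> p) 1 (D Y \<xi> p)) (?S p) = 0"
    using xi_Killing_diagonal[OF S, of p] by simp
  then show ?thesis
    using metric_facts(1)[OF R D_tangent[OF X xi_field] D_tangent[OF Y xi_field] field_tangent[OF S], of p 1 1]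
      metric_facts(3)[OF R field_tangent[OF X] field_tangent[OF Y] D_tangent[OF X xi_field] M, of p 1 1]
      metric_facts(3)[OF R field_tangent[OF X] field_tangent[OF Y] D_tangent[OF Y xi_field] M, of p 1 1]
      xi_Killing_diagonal[OF X, of p] xi_Killing_diagonal[OF Y, of p]
    by simp
qed

text \<open>
Pair the nearly Sasakian condition for \<open>X\<close>, \<open>\<xi>\<close> with \<open>X\<close>: the terms with \<open>\<nabla>\<^sub>\<xi>\<close> add up to the derivative
along \<open>\<xi>\<close> of \<open>g (\<phi> X) X = 0\<close>.
\<close>

lemma D_xi_phi:
  assumes X: "X \<in> vector_fields M"
  shows "g p (D X \<xi> p) (\<phi> p (X p)) = - \<alpha> p * (g p (X p) (X p) - (\<eta> p (X p))\<^sup>2)"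
proof -
  note R = contact_riemannian
  have Xp: "X p \<in> tangent_space M p" by (rule field_tangent[OF X])
  have \<phi>X: "(\<lambda>q. \<phi> q (X q)) \<in> vector_fields M" by (rule phi_field[OF X])
  have DX: "D \<xi> X p \<in> tangent_space M p" by (rule D_tangent[OF xi_field X])
  have "\<xi> p (\<lambda>q. g q (\<phi> q (X q)) (X q)) = 0"
    using tangent_fun_const[OF M xi_tangent]
    by (simp add: g_phi_self[OF field_tangent[OF X]])
  then have "g p (D \<xi> (\<lambda>q. \<phi> q (X q)) p) (X p) + g p (\<phi> p (X p)) (D \<xi> X p) = 0"
    using levi_civita_facts(3)[OF contact_levi_civita xi_field \<phi>X X, of p] by simp
  then have "g p (D \<xi> (\<lambda>q. \<phi> q (X q)) p) (X p) = g p (\<phi> p (D \<xi> X p)) (X p)"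
    using phi_skew[OF DX Xp] metric_facts(2)[OF R phi_tangent[OF Xp] DX DX] by simp
  then show ?thesis
    using g_phi_D_xi[OF X Xp] phi_skew[OF D_tangent[OF X xi_field] Xp] by (simp add: power2_eq_square)
qed

end

section \<open>Mixed totally geodesic warped products\<close>

lemma factor_field_facts:
  "X \<in> first_factor_fields A B \<Longrightarrow> X \<in> vector_fields (prod_atlas A B)"
  "X \<in> first_factor_fields A B \<Longrightarrow> differential B snd (X p) = zero_vector"
  "X \<in> first_factor_fields A B \<Longrightarrow> f \<in> smooth_funs B \<Longrightarrow> X p (\<lambda>q. f (snd q)) = 0"
  "Z \<in> second_factor_fields A B \<Longrightarrow> Z \<in> vector_fields (prod_atlas A B)"
  "Z \<in> second_factor_fields A B \<Longrightarrow> differential A fst (Z p) = zero_vector"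
  "Z \<in> second_factor_fields A B \<Longrightarrow> h \<in> smooth_funs A \<Longrightarrow> Z p (\<lambda>q. h (fst q)) = 0"
proof -
  assume X: "X \<in> first_factor_fields A B"
  show "X \<in> vector_fields (prod_atlas A B)" and 1: "differential B snd (X p) = zero_vector"
    using X unfolding first_factor_fields_def by blast+
  show "X p (\<lambda>q. f (snd q)) = 0" if "f \<in> smooth_funs B"
    using fun_cong[OF 1, of f] that by (simp add: differential_def zero_vector_def comp_def)
next
  assume Z: "Z \<in> second_factor_fields A B"
  show "Z \<in> vector_fields (prod_atlas A B)" and 1: "differential A fst (Z p) = zero_vector"
    using Z unfolding second_factor_fields_def by blast+
  show "Z p (\<lambda>q. h (fst q)) = 0" if "h \<in> smooth_funs A"
    using fun_cong[OF 1, of h] that by (simp add: differential_def zero_vector_def comp_def)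
qed

theorem proposition4p9:
  fixes M :: "('a::{t2_space,second_countable_topology}, 'e::euclidean_space) chart set"
    and \<phi> :: "'a \<Rightarrow> 'a tangent \<Rightarrow> 'a tangent"
    and \<xi> :: "'a \<Rightarrow> 'a tangent"
    and \<eta> :: "'a \<Rightarrow> 'a tangent \<Rightarrow> real"
    and g :: "'a \<Rightarrow> 'a tangent \<Rightarrow> 'a tangent \<Rightarrow> real"
    and D :: "('a \<Rightarrow> 'a tangent) \<Rightarrow> ('a \<Rightarrow> 'a tangent) \<Rightarrow> 'a \<Rightarrow> 'a tangent"
    and \<alpha> :: "'a \<Rightarrow> real"
    and l :: nat
  assumes "smooth_atlas M"
    and "DIM('e) = 2 * l + 1"
    and "\<alpha> \<in> smooth_funs M"
    and "\<forall>p. \<alpha> p \<noteq> 0"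
    and "nearly_sasakian M \<phi> \<xi> \<eta> g D \<alpha>"
  shows "\<not> (\<exists>(N1 :: ('b::{t2_space,second_countable_topology}, 'f::euclidean_space) chart set) g1
              (N2 :: ('c::{t2_space,second_countable_topology}, 'h::euclidean_space) chart set) g2
              f F DA DF.
            smooth_atlas N1 \<and> riemannian_metric N1 g1 \<and>
            smooth_atlas N2 \<and> riemannian_metric N2 g2 \<and>
            f \<in> smooth_funs N1 \<and> (\<forall>x. f x > 0) \<and>
            isometric_immersion (prod_atlas N1 N2) (warped_metric N1 g1 N2 g2 f) M g F \<and>
            levi_civita (prod_atlas N1 N2) (warped_metric N1 g1 N2 g2 f) DA \<and>
            pullback_connection (prod_atlas N1 N2) M F D DF \<and>
            mixed_totally_geodesic N1 N2 M F DA DF \<and>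
            tangent_to_first_factor N1 N2 M F \<xi>)"
proof (rule notI, elim exE conjE)
  fix N1 :: "('b::{t2_space,second_countable_topology}, 'f::euclidean_space) chart set"
    and N2 :: "('c::{t2_space,second_countable_topology}, 'h::euclidean_space) chart set"
    and g1 g2 f F DA DF
  let ?P = "prod_atlas N1 N2" and ?G = "warped_metric N1 g1 N2 g2 f"
  assume N1: "smooth_atlas N1" and g1: "riemannian_metric N1 g1" and N2: "smooth_atlas N2"
    and g2: "riemannian_metric N2 g2" and iso: "isometric_immersion ?P ?G M g F"
    and DA: "levi_civita ?P ?G DA" and DF: "pullback_connection ?P M F D DF"
    and mtg: "mixed_totally_geodesic N1 N2 M F DA DF" and tan: "tangent_to_first_factor N1 N2 M F \<xi>"
  note M = assms(1) and ns = assms(5)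
  note R = contact_riemannian[OF M ns] and LC = contact_levi_civita[OF M ns] and \<xi> = xi_field[OF M ns]
  have P: "smooth_atlas ?P" by (rule smooth_atlas_prod[OF N1 N2])
  have F: "smooth_map ?P M F" and inj: "\<And>p. inj_on (differential M F) (tangent_space ?P p)"
    and isom: "\<And>p u v. u \<in> tangent_space ?P p \<Longrightarrow> v \<in> tangent_space ?P p \<Longrightarrow>
      g (F p) (differential M F u) (differential M F v) = ?G p u v"
    using iso unfolding isometric_immersion_def by blast+
  note vf1 = factor_field_facts(1) and vf2 = factor_field_facts(4)
  note tng = field_tangent
  let ?d = "differential M F"
  have dtan: "?d u \<in> tangent_space M (F p)" if "u \<in> tangent_space ?P p" for u p
    by (rule differential_tangent[OF P M F that])
  have DAt: "DA X Y p \<in> tangent_space ?P p" if "X \<in> vector_fields ?P" "Y \<in> vector_fields ?P" for X Y p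
    by (rule tng[OF levi_civita_field[OF DA that]])
  have Gsym: "?G p u v = ?G p v u" if "u \<in> tangent_space ?P p" "v \<in> tangent_space ?P p" for p u v
    using isom[OF that] isom[OF that(2,1)] metric_facts(2)[OF R dtan[OF that(1)] dtan[OF that(2)] dtan[OF that(2)]]
    by simp
  have Glin: "?G p (lincomb a u b v) w = a * ?G p u w + b * ?G p v w"
    "?G p w (lincomb a u b v) = a * ?G p w u + b * ?G p w v"
    if "u \<in> tangent_space ?P p" "v \<in> tangent_space ?P p" "w \<in> tangent_space ?P p" for p u v w a b
    using isom[OF tangent_lincomb[OF P that(1,2)] that(3)] isom[OF that(3) tangent_lincomb[OF P that(1,2)]]
      isom[OF that(1,3)] isom[OF that(2,3)] isom[OF that(3,1)] isom[OF that(3,2)]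
      metric_facts(1,3)[OF R dtan[OF that(1)] dtan[OF that(2)] dtan[OF that(3)]] M
    by (simp_all add: differential_lincomb)
  note compat = levi_civita_facts(3)[OF DA] and torsion = levi_civita_facts(2)[OF DA]
  have fst_tan: "differential N1 fst u \<in> tangent_space N1 (fst p)" if "u \<in> tangent_space ?P p" for u p
    by (rule differential_tangent[OF P N1 smooth_map_fst[OF N1 N2] that])
  have snd_tan: "differential N2 snd u \<in> tangent_space N2 (snd p)" if "u \<in> tangent_space ?P p" for u p
    by (rule differential_tangent[OF P N2 smooth_map_snd[OF N1 N2] that])
  have G1: "?G p (X p) u = g1 (fst p) (differential N1 fst (X p)) (differential N1 fst u)"
    if "X \<in> first_factor_fields N1 N2" "u \<in> tangent_space ?P p" for X u p
    using metric_zero(1)[OF N2 g2 snd_tan[OF that(2)]] factor_field_facts(2)[OF that(1)]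
    by (simp add: warped_metric_def)
  have orth: "?G p (X p) (Z p) = 0" if X: "X \<in> first_factor_fields N1 N2" and Z: "Z \<in> second_factor_fields N1 N2" for X Z p
    unfolding G1[OF X tng[OF vf2[OF Z]]]
    using metric_zero(2)[OF N1 g1 fst_tan[OF tng[OF vf1[OF X]]]] factor_field_facts(5)[OF Z] by simp
  have const: "X p (\<lambda>q. k) = 0" if "X \<in> vector_fields ?P" for X p and k :: real
    by (rule tangent_fun_const[OF P tng[OF that]])
  have bracket1: "differential N2 snd (lie_bracket ?P X Y p) = zero_vector"
    if X: "X \<in> first_factor_fields N1 N2" and Y: "Y \<in> first_factor_fields N1 N2" for X Y p
    by (rule ext) (simp add: differential_def lie_bracket_def zero_vector_def comp_def
        factor_field_facts(3)[OF X] factor_field_facts(3)[OF Y] const[OF vf1[OF X]] const[OF vf1[OF Y]])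
  have bracket2: "differential N1 fst (lie_bracket ?P X Y p) = zero_vector"
    if X: "X \<in> second_factor_fields N1 N2" and Y: "Y \<in> second_factor_fields N1 N2" for X Y p
    by (rule ext) (simp add: differential_def lie_bracket_def zero_vector_def comp_def
        factor_field_facts(6)[OF X] factor_field_facts(6)[OF Y] const[OF vf2[OF X]] const[OF vf2[OF Y]])
  have brt: "lie_bracket ?P X Y p \<in> tangent_space ?P p" if "X \<in> vector_fields ?P" "Y \<in> vector_fields ?P" for X Y p
    by (rule lie_bracket_tangent[OF P DA that])
  have brG: "?G p (lie_bracket ?P X Y p) w = ?G p (DA X Y p) w - ?G p (DA Y X p) w"
    if "X \<in> vector_fields ?P" "Y \<in> vector_fields ?P" "w \<in> tangent_space ?P p" for X Y p w
    unfolding torsion[OF that(1,2), symmetric]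
    using Glin(1)[OF DAt[OF that(1,2)] DAt[OF that(2,1)] that(3), of 1 "-1"] by simp

  \<comment> \<open>The leaves \<open>N1 \<times> {y}\<close> are totally geodesic. With \<open>b X Y = \<langle>\<nabla>\<^sub>X Z, Y\<rangle>\<close> for \<open>X\<close>, \<open>Y\<close> tangent to the first
    factor, \<open>b\<close> is skew because the metric of \<open>N1\<close> does not change along \<open>Z\<close>, and symmetric because
    \<open>b X Y = - \<langle>Z, \<nabla>\<^sub>X Y\<rangle>\<close> and \<open>[X, Y]\<close> is tangent to the first factor.\<close>
  have geodesic: "?G p (DA X Z p) (Y p) = 0"
    if X: "X \<in> first_factor_fields N1 N2" and Y: "Y \<in> first_factor_fields N1 N2"
      and Z: "Z \<in> second_factor_fields N1 N2" for X Y Z p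
  proof -
    note X' = vf1[OF X] and Y' = vf1[OF Y] and Z' = vf2[OF Z]
    have lie: "(\<lambda>h. Z p (\<lambda>q. differential N1 fst (U q) h)) = differential N1 fst (lie_bracket ?P Z U p)"
      if U: "U \<in> first_factor_fields N1 N2" for U
    proof
      fix h
      show "Z p (\<lambda>q. differential N1 fst (U q) h) = differential N1 fst (lie_bracket ?P Z U p) h"
      proof (cases "h \<in> smooth_funs N1")
        case True
        then show ?thesis
          using factor_field_facts(6)[OF Z True] const[OF vf1[OF U]]
            smooth_funs_compose[OF P N1 smooth_map_fst[OF N1 N2] True]
          by (simp add: differential_def lie_bracket_def comp_def)
      qed (use const[OF Z'] in \<open>simp add: differential_def\<close>)
    qed
    have fields: "(\<lambda>q. differential N1 fst (U q)) \<in> fields_along ?P N1 fst" if "U \<in> vector_fields ?P" for U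
      by (rule field_along_differential[OF P N1 smooth_map_fst[OF N1 N2] that])
    have "(\<lambda>q. ?G q (X q) (Y q)) = (\<lambda>q. g1 (fst q) (differential N1 fst (X q)) (differential N1 fst (Y q)))"
      using G1[OF X tng[OF Y']] by simp
    then have "Z p (\<lambda>q. ?G q (X q) (Y q)) =
        g1 (fst p) (differential N1 fst (lie_bracket ?P Z X p)) (differential N1 fst (Y p)) +
        g1 (fst p) (differential N1 fst (X p)) (differential N1 fst (lie_bracket ?P Z Y p))"
      using metric_along_derivative(2)[OF P N1 smooth_map_fst[OF N1 N2] g1 fields[OF X'] fields[OF Y'] tng[OF Z']
          factor_field_facts(6)[OF Z]]
      by (simp add: lie[OF X] lie[OF Y])
    also have "\<dots> = ?G p (lie_bracket ?P Z X p) (Y p) + ?G p (X p) (lie_bracket ?P Z Y p)"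
      using G1[OF X brt[OF Z' Y']] G1[OF Y brt[OF Z' X']] Gsym[OF brt[OF Z' X'] tng[OF Y']]
        metric_facts(2)[OF g1 fst_tan[OF brt[OF Z' X']] fst_tan[OF tng[OF Y']] fst_tan[OF tng[OF Y']]]
      by simp
    finally have 1: "?G p (DA Z X p) (Y p) + ?G p (X p) (DA Z Y p) =
        ?G p (lie_bracket ?P Z X p) (Y p) + ?G p (X p) (lie_bracket ?P Z Y p)"
      using compat[OF Z' X' Y', of p] by simp
    have skew: "?G p (DA X Z p) (Y p) + ?G p (DA Y Z p) (X p) = 0"
      using 1 brG[OF Z' X' tng[OF Y']] brG[OF Z' Y' tng[OF X']]
        Gsym[OF tng[OF X'] DAt[OF Z' Y']] Gsym[OF tng[OF X'] brt[OF Z' Y']] by simp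
    have swap: "?G p (DA U Z p) (W p) = - ?G p (DA U W p) (Z p)"
      if U: "U \<in> first_factor_fields N1 N2" and W: "W \<in> first_factor_fields N1 N2" for U W
      using compat[OF vf1[OF U] Z' vf1[OF W], of p] const[OF vf1[OF U]]
        orth[OF W Z] Gsym[OF tng[OF Z'] tng[OF vf1[OF W]]] Gsym[OF tng[OF Z'] DAt[OF vf1[OF U] vf1[OF W]]]
      by simp
    have "?G p (lie_bracket ?P X Y p) (Z p) = 0"
      using bracket1[OF X Y] factor_field_facts(5)[OF Z] metric_zero(1)[OF N2 g2 snd_tan[OF tng[OF Z']]]
        metric_zero(2)[OF N1 g1 fst_tan[OF brt[OF X' Y']]]
      by (simp add: warped_metric_def)
    then have "?G p (DA X Z p) (Y p) = ?G p (DA Y Z p) (X p)"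
      using swap[OF X Y] swap[OF Y X] brG[OF X' Y' tng[OF Z']] by simp
    then show ?thesis using skew by simp
  qed

  obtain X0 where X0: "X0 \<in> first_factor_fields N1 N2" and rel: "\<And>p. ?d (X0 p) = \<xi> (F p)"
    using tan unfolding tangent_to_first_factor_def by blast
  note X0' = vf1[OF X0]
  have pull: "DF X (\<lambda>q. ?d (Z q)) p = ?d (DA X Z p)"
    if X: "X \<in> first_factor_fields N1 N2" and Z: "Z \<in> second_factor_fields N1 N2" for X Z p
  proof
    fix h
    have "second_fundamental_form M F DA DF X Z p = zero_vector"
      using mtg X Z unfolding mixed_totally_geodesic_def by blast
    from fun_cong[OF this, of h] show "DF X (\<lambda>q. ?d (Z q)) p h = ?d (DA X Z p) h"
      by (simp add: second_fundamental_form_def lincomb_def zero_vector_def)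
  qed
  \<comment> \<open>Only \<open>h X0 Z = 0\<close> is given directly; \<open>h Z X0 = 0\<close> follows as both connections are torsion free.\<close>
  have pull_xi: "DF Z (\<lambda>q. \<xi> (F q)) p = ?d (DA Z X0 p)" if Z: "Z \<in> second_factor_fields N1 N2" for Z p
  proof
    fix h
    have "?d (lie_bracket ?P Z X0 p) h = ?d (DA Z X0 p) h - ?d (DA X0 Z p) h"
      unfolding torsion[OF vf2[OF Z] X0', symmetric] by (simp add: differential_def lincomb_def)
    then show "DF Z (\<lambda>q. \<xi> (F q)) p h = ?d (DA Z X0 p) h"
      using pullback_torsion_free[OF P M F R LC DF vf2[OF Z] X0' \<xi> rel brt[OF vf2[OF Z] X0'], of p h]
      by (simp add: pull[OF X0 Z])
  qed

  have Killing: "g (F p) (DF X (\<lambda>q. \<xi> (F q)) p) (?d (Y p)) + g (F p) (DF Y (\<lambda>q. \<xi> (F q)) p) (?d (X p)) = 0"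
    if X: "X \<in> vector_fields ?P" and Y: "Y \<in> vector_fields ?P" for X Y p
  proof -
    obtain V where V: "V \<in> vector_fields M" "V (F p) = ?d (X p)"
      by (rule field_extension[OF M dtan[OF tng[OF X]]])
    obtain W where W: "W \<in> vector_fields M" "W (F p) = ?d (Y p)"
      by (rule field_extension[OF M dtan[OF tng[OF Y]]])
    show ?thesis
      using xi_Killing[OF M ns V(1) W(1), of "F p"] V(2) W(2)
        pullback_eq[OF P M F R LC DF X V(1) \<xi> V(2)] pullback_eq[OF P M F R LC DF Y W(1) \<xi> W(2)]
      by simp
  qed

  fix p :: "'b \<times> 'c"
  obtain Z where Z: "Z \<in> second_factor_fields N1 N2" and Z0: "Z p \<noteq> zero_vector"
    by (rule second_factor_field_nonzero[OF N1 N2])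
  note Z' = vf2[OF Z]
  let ?u = "DA Z X0 p"
  have u: "?u \<in> tangent_space ?P p" by (rule DAt[OF Z' X0'])

  have u2: "?G p ?u (V p) = 0" if V: "V \<in> second_factor_fields N1 N2" for V
  proof -
    note V' = vf2[OF V]
    have "?G p (DA Z X0 p) (V p) + ?G p (DA V X0 p) (Z p) = 0"
      using Killing[OF Z' V', of p] isom[OF DAt[OF Z' X0'] tng[OF V']] isom[OF DAt[OF V' X0'] tng[OF Z']]
      by (simp add: pull_xi[OF Z] pull_xi[OF V])
    moreover have swap: "?G p (DA U X0 p) (W p) = - ?G p (DA U W p) (X0 p)"
      if U: "U \<in> second_factor_fields N1 N2" and W: "W \<in> second_factor_fields N1 N2" for U W
      using compat[OF vf2[OF U] X0' vf2[OF W], of p] const[OF vf2[OF U]] orth[OF X0 W]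
        Gsym[OF tng[OF X0'] DAt[OF vf2[OF U] vf2[OF W]]] by simp
    moreover have "?G p (lie_bracket ?P Z V p) (X0 p) = 0"
      using bracket2[OF Z V] factor_field_facts(2)[OF X0] metric_zero(1)[OF N1 g1 fst_tan[OF tng[OF X0']]]
        metric_zero(2)[OF N2 g2 snd_tan[OF brt[OF Z' V']]]
      by (simp add: warped_metric_def)
    ultimately show ?thesis
      using swap[OF Z V] swap[OF V Z] brG[OF Z' V' tng[OF X0']] by simp
  qed
  have u1: "?G p ?u (X p) = 0" if X: "X \<in> first_factor_fields N1 N2" for X
  proof -
    note X' = vf1[OF X]
    have "g (F q) (?d (Z q)) (\<xi> (F q)) = 0" for q
      using isom[OF tng[OF Z'] tng[OF X0']] orth[OF X0 Z] Gsym[OF tng[OF Z'] tng[OF X0']] by (simp add: rel)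
    then have "g (F p) (DF X (\<lambda>q. ?d (Z q)) p) (\<xi> (F p)) + g (F p) (?d (Z p)) (DF X (\<lambda>q. \<xi> (F q)) p) = 0"
      using pullback_metric[OF P M F R LC DF X' field_along_differential[OF P M F Z'] \<xi>, of p] const[OF X'] by simp
    moreover have "g (F p) (DF X (\<lambda>q. ?d (Z q)) p) (\<xi> (F p)) = 0"
      using isom[OF DAt[OF X' Z'] tng[OF X0']] geodesic[OF X X0 Z] by (simp add: pull[OF X Z] rel)
    moreover have "DF X (\<lambda>q. \<xi> (F q)) p \<in> tangent_space M (F p)"
      by (rule tng[OF connection_facts(1)[OF P M F DF[unfolded pullback_connection_def, THEN conjunct1]
            X' field_along_restrict[OF P M F \<xi>]]])
    ultimately have "g (F p) (DF X (\<lambda>q. \<xi> (F q)) p) (?d (Z p)) = 0"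
      using metric_facts(2)[OF R dtan[OF tng[OF Z']] _ dtan[OF tng[OF Z']]] by simp
    then show ?thesis
      using Killing[OF Z' X', of p] isom[OF u tng[OF X']] by (simp add: pull_xi[OF Z])
  qed
  \<comment> \<open>\<open>u\<close> is orthogonal to both factors, hence to itself.\<close>
  obtain X V where XV: "X \<in> first_factor_fields N1 N2" "V \<in> second_factor_fields N1 N2" "?u = lincomb 1 (X p) 1 (V p)"
    by (rule tangent_split[OF N1 N2 u])
  have "?G p ?u ?u = 0"
    using Glin(2)[OF tng[OF vf1[OF XV(1)]] tng[OF vf2[OF XV(2)]] u, of 1 1] u1[OF XV(1)] u2[OF XV(2)]
    by (simp add: XV(3)[symmetric])
  then have "g (F p) (?d ?u) (?d ?u) = 0" using isom[OF u u] by simp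
  then have du: "?d ?u = zero_vector" by (rule metric_definite[OF R dtan[OF u]])

  obtain W where W: "W \<in> vector_fields M" "W (F p) = ?d (Z p)"
    by (rule field_extension[OF M dtan[OF tng[OF Z']]])
  have "D W \<xi> (F p) = zero_vector"
    using pullback_eq[OF P M F R LC DF Z' W(1) \<xi> W(2)] pull_xi[OF Z] du by simp
  moreover have "\<eta> (F p) (W (F p)) = 0"
    using eta_eq[OF M ns tng[OF W(1), of "F p"]] isom[OF tng[OF Z'] tng[OF X0']] orth[OF X0 Z] Gsym[OF tng[OF Z'] tng[OF X0']]
    by (simp add: rel W(2))
  ultimately have "\<alpha> (F p) * g (F p) (?d (Z p)) (?d (Z p)) = 0"
    using D_xi_phi[OF M ns W(1), of "F p"] metric_zero(1)[OF M R phi_tangent[OF M ns tng[OF W(1), of "F p"]]]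
    by (simp add: W(2))
  then have "g (F p) (?d (Z p)) (?d (Z p)) = 0" using assms(4) by simp
  then have "?d (Z p) = zero_vector" by (rule metric_definite[OF R dtan[OF tng[OF Z']]])
  moreover have "?d zero_vector = zero_vector" by (simp add: differential_def zero_vector_def)
  ultimately show False
    using inj_onD[OF inj _ tng[OF Z'] tangent_zero[OF P]] Z0 by simp
qed

end
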